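(* Let $k$ be a field, let $\Delta$ be a matroid on $[n]$ with cover ideal $J=J(\Delta)\subseteq R=k[x_1,\ldots,x_n]$, and let $c=\operatorname{ht} J=r(\Delta)$, with $c>1$. The following are equivalent: (1) $\Delta$ is a paving matroid; (2) $SF_\ell(J)$ is a star configuration of height $c-\ell+1$ for all $2\le\ell\le c$; (3) $\alpha(SF_\ell(J))=n-c+\ell$ for all $2\le\ell\le c$; (4) $SF_2(J)$ is a star configuration of height $c-1$; (5) $\alpha(SF_2(J))=n-c+2$.
   Context: A matroid on $[n]$ is identified with the simplicial complex whose facets are its bases (loops allowed); $r(\Delta)$ is its rank. A matroid is paving if all its circuits have size at least $r(\Delta)$. The cover ideal is $J(\Delta)=\bigcap_F(x_i:i\in F)$, intersection over the bases $F$. For a squarefree monomial ideal $J$, $J^{(\ell)}=\bigcap_{\mathfrak p\in\operatorname{Ass}(R/J)}\mathfrak p^\ell$, and $SF_\ell(J)$ is the ideal generated by all squarefree monomials in $J^{(\ell)}$. For a nonzero homogeneous ideal $L$, $\alpha(L)$ is the smallest degree of a nonzero element of $L$. "Star configuration of height $h$" means the (monomial) star configuration ideal of height $h$ in $R$, i.e. the cover ideal $\bigcap_{F\subseteq[n],|F|=h}(x_i:i\in F)$ of the uniform matroid of rank $h$ on $[n]$. *)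

theory Defs
  imports
    "HOL-Library.Poly_Mapping"
    "HOL-Library.Extended_Nat"
    "HOL-Algebra.Ideal_Product"
    "HOL-Algebra.QuotRing"
    "HOL-Algebra.Algebraic_Closure_Type"
begin

section \<open>Matroids as simplicial complexes\<close>

text \<open>A matroid is given by the simplicial complex \<open>\<Delta>\<close> of its independent sets. Singletons
  do not have to belong to \<open>\<Delta>\<close>, so loops are allowed.\<close>

definition matroid :: "'a set \<Rightarrow> 'a set set \<Rightarrow> bool" where
  "matroid E \<Delta> \<longleftrightarrow>
     finite E \<and> \<Delta> \<subseteq> Pow E \<and> {} \<in> \<Delta> \<and>
     (\<forall>A\<in>\<Delta>. \<forall>B. B \<subseteq> A \<longrightarrow> B \<in> \<Delta>) \<and>
     (\<forall>A\<in>\<Delta>. \<forall>B\<in>\<Delta>. card A < card B \<longrightarrow> (\<exists>x\<in>B - A. insert x A \<in> \<Delta>))"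

definition matroid_bases :: "'a set set \<Rightarrow> 'a set set" where
  "matroid_bases \<Delta> = {F \<in> \<Delta>. \<forall>G\<in>\<Delta>. F \<subseteq> G \<longrightarrow> G = F}"

definition matroid_rank :: "'a set set \<Rightarrow> nat" where
  "matroid_rank \<Delta> = Max (card ` \<Delta>)"

definition matroid_circuits :: "'a set \<Rightarrow> 'a set set \<Rightarrow> 'a set set" where
  "matroid_circuits E \<Delta> = {C. C \<subseteq> E \<and> C \<notin> \<Delta> \<and> (\<forall>D. D \<subset> C \<longrightarrow> D \<in> \<Delta>)}"

definition paving :: "'a set \<Rightarrow> 'a set set \<Rightarrow> bool" where
  "paving E \<Delta> \<longleftrightarrow> matroid E \<Delta> \<and> (\<forall>C\<in>matroid_circuits E \<Delta>. matroid_rank \<Delta> \<le> card C)"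


section \<open>Height, associated primes and symbolic powers\<close>

text \<open>The height of a prime \<open>P\<close> is the supremum of the lengths \<open>m\<close> of chains of primes
  \<open>C 0 \<subset> \<dots> \<subset> C m = P\<close>; values of \<open>C\<close> beyond \<open>m\<close> are irrelevant.\<close>

definition prime_height :: "('a, 'b) ring_scheme \<Rightarrow> 'a set \<Rightarrow> enat" where
  "prime_height R P = Sup {enat m | m. \<exists>C :: nat \<Rightarrow> 'a set.
     (\<forall>i\<le>m. primeideal (C i) R) \<and> (\<forall>i<m. C i \<subset> C (Suc i)) \<and> C m = P}"

definition ideal_height :: "('a, 'b) ring_scheme \<Rightarrow> 'a set \<Rightarrow> enat" where
  "ideal_height R I = Inf {prime_height R P | P. primeideal P R \<and> I \<subseteq> P}"

text \<open>Annihilator in \<open>R\<close> of an element \<open>x\<close> of the \<open>R\<close>-module \<open>R/J\<close>, where \<open>g\<close> acts as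
  multiplication by its residue class.\<close>

definition quot_annihilator :: "('a, 'b) ring_scheme \<Rightarrow> 'a set \<Rightarrow> 'a set \<Rightarrow> 'a set" where
  "quot_annihilator R J x =
     {g \<in> carrier R. (J +>\<^bsub>R\<^esub> g) \<otimes>\<^bsub>R Quot J\<^esub> x = \<zero>\<^bsub>R Quot J\<^esub>}"

definition quot_Ass :: "('a, 'b) ring_scheme \<Rightarrow> 'a set \<Rightarrow> 'a set set" where
  "quot_Ass R J =
     {P. primeideal P R \<and> (\<exists>x\<in>carrier (R Quot J). P = quot_annihilator R J x)}"

text \<open>Ordinary powers of ideals are powers in the monoid of ideals under the ideal product.
  The factor \<^term>\<open>carrier R\<close> only matters for \<open>J = R\<close>, where the intersection is empty.\<close>

definition symbolic_power :: "('a, 'b) ring_scheme \<Rightarrow> 'a set \<Rightarrow> nat \<Rightarrow> 'a set" where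
  "symbolic_power R J l =
     carrier R \<inter> (\<Inter>P\<in>quot_Ass R J. P [^]\<^bsub>ideals_set R\<^esub> l)"


section \<open>Ideals in the polynomial ring in n variables\<close>

text \<open>An element of \<open>'k mpoly\<close> maps an exponent vector to its coefficient. The ring
  \<open>k[x\<^sub>1, \<dots>, x\<^sub>n]\<close> is cut out by allowing only the variables with index in \<open>{1..n}\<close>.\<close>

type_synonym 'k mpoly = "(nat \<Rightarrow>\<^sub>0 nat) \<Rightarrow>\<^sub>0 'k"

definition mpoly_ring :: "nat \<Rightarrow> 'k::field mpoly ring" where
  "mpoly_ring n = ring_of_type_algebra
     \<lparr>carrier := {p. \<forall>m\<in>Poly_Mapping.keys p. Poly_Mapping.keys m \<subseteq> {1..n}}\<rparr>"

definition mpoly_monomial :: "(nat \<Rightarrow>\<^sub>0 nat) \<Rightarrow> 'k::field mpoly" where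
  "mpoly_monomial m = Poly_Mapping.single m 1"

definition mpoly_var :: "nat \<Rightarrow> 'k::field mpoly" where
  "mpoly_var i = mpoly_monomial (Poly_Mapping.single i 1)"

definition var_ideal :: "nat \<Rightarrow> nat set \<Rightarrow> 'k::field mpoly set" where
  "var_ideal n F = Idl\<^bsub>mpoly_ring n\<^esub> (mpoly_var ` F)"

definition cover_ideal :: "nat \<Rightarrow> nat set set \<Rightarrow> 'k::field mpoly set" where
  "cover_ideal n \<Delta> = (\<Inter>F\<in>matroid_bases \<Delta>. var_ideal n F)"

definition star_configuration :: "nat \<Rightarrow> nat \<Rightarrow> 'k::field mpoly set" where
  "star_configuration n h =
     carrier (mpoly_ring n) \<inter> (\<Inter>F\<in>{F. F \<subseteq> {1..n} \<and> card F = h}. var_ideal n F)"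

definition squarefree_exponent :: "(nat \<Rightarrow>\<^sub>0 nat) \<Rightarrow> bool" where
  "squarefree_exponent m \<longleftrightarrow> (\<forall>i. Poly_Mapping.lookup m i \<le> 1)"

definition SF :: "nat \<Rightarrow> nat \<Rightarrow> 'k::field mpoly set \<Rightarrow> 'k mpoly set" where
  "SF n l J = Idl\<^bsub>mpoly_ring n\<^esub>
     {mpoly_monomial m | m. squarefree_exponent m \<and> mpoly_monomial m \<in> symbolic_power (mpoly_ring n) J l}"

definition exponent_degree :: "(nat \<Rightarrow>\<^sub>0 nat) \<Rightarrow> nat" where
  "exponent_degree m = (\<Sum>i\<in>Poly_Mapping.keys m. Poly_Mapping.lookup m i)"

text \<open>Only meaningful for nonzero polynomials.\<close>

definition total_degree :: "'k::field mpoly \<Rightarrow> nat" where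
  "total_degree p = Max (exponent_degree ` Poly_Mapping.keys p)"

text \<open>Only meaningful for nonzero ideals.\<close>

definition initial_degree :: "'k::field mpoly set \<Rightarrow> nat" where
  "initial_degree L = (LEAST d. \<exists>f\<in>L. f \<noteq> 0 \<and> total_degree f = d)"


section \<open>Equivalence of a list of statements\<close>

definition all_equivalent :: "bool list \<Rightarrow> bool" where
  "all_equivalent Ps \<longleftrightarrow> (\<forall>P\<in>set Ps. \<forall>Q\<in>set Ps. P \<longleftrightarrow> Q)"

end

theory Submission
  imports Defs
begin

text \<open>
  Write \<open>P\<^sub>F\<close> for the prime ideal generated by the variables in \<open>F\<close>. The associated primes of \<open>R/J\<close>
  are the \<open>P\<^sub>F\<close> for the bases \<open>F\<close>, and a squarefree monomial with support \<open>S\<close> lies in \<open>P\<^sub>F\<close>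
  to the power \<open>l\<close> iff \<open>S\<close> meets \<open>F\<close> in at least \<open>l\<close> elements. So both the ideals \<open>SF\<^sub>l\<close> and the
  star configurations are determined by the supports of their monomials. If the matroid is paving,
  every subset of the complement of \<open>S\<close> with at most \<open>c - 1\<close> elements is independent, and
  extending such a set to a basis shows that \<open>S\<close> belongs to \<open>SF\<^sub>l\<close> iff it has at least \<open>n - c + l\<close>
  elements. Conversely, a circuit of size less than \<open>c\<close> extends to a dependent set \<open>T\<close> with \<open>c - 1\<close>
  elements; every basis has two elements outside \<open>T\<close>, so the complement of \<open>T\<close> gives an
  element of \<open>SF\<^sub>2\<close> of degree \<open>n - c + 1\<close>.

  The height of \<open>P\<^sub>F\<close> is bounded without Krull's theorem. In a longer chain of primes one
  could pick \<open>card F + 1\<close> elements, one from each step; by counting exponents they satisfy a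
  polynomial relation whose coefficients involve only the variables outside \<open>F\<close>. Dividing by the
  lowest power of one element after the other along the chain forces a nonzero such coefficient
  into \<open>P\<^sub>F\<close>.
\<close>

section \<open>Primes containing finite intersections\<close>

context cring begin

text \<open>If \<open>I\<close> is not inside \<open>P\<close>, an element \<open>a\<close> of
  \<open>I\<close> outside \<open>P\<close> multiplies the intersection of the other members into
  the full intersection, hence into \<open>P\<close>; primeness then puts that smaller intersection
  into \<open>P\<close>. With the factor \<open>carrier R\<close> the empty family stands for the
  unit ideal, which no prime contains.\<close>

lemma primeideal_contains_member_of_Inter:
  assumes "finite \<A>" "\<And>I. I \<in> \<A> \<Longrightarrow> ideal I R" "primeideal P R" "carrier R \<inter> \<Inter>\<A> \<subseteq> P"
  shows "\<exists>I\<in>\<A>. I \<subseteq> P"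
  using assms(1,2,4)
proof (induction \<A> rule: finite_induct)
  case empty
  interpret P: primeideal P R by fact
  show ?case using empty P.I_notcarr P.a_subset by auto
next
  case (insert I \<A>)
  interpret P: primeideal P R by fact
  interpret I: ideal I R using insert.prems by simp
  show ?case
  proof (cases "I \<subseteq> P")
    case False
    then obtain a where a: "a \<in> I" "a \<notin> P" by auto
    have "carrier R \<inter> \<Inter>\<A> \<subseteq> P"
    proof
      fix b assume b: "b \<in> carrier R \<inter> \<Inter>\<A>"
      have "a \<otimes> b \<in> J" if "J \<in> \<A>" for J
      proof -
        interpret J: ideal J R using insert.prems that by simp
        show ?thesis using a b that J.I_l_closed by auto
      qed
      then have "a \<otimes> b \<in> P"
        using insert.prems(2) a b I.I_r_closed by auto
      then show "b \<in> P" using P.I_prime[of a b] a b I.Icarr by auto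
    qed
    then show ?thesis using insert by auto
  qed auto
qed

lemma ideal_carrier_Inter:
  assumes "\<And>I. I \<in> \<A> \<Longrightarrow> ideal I R"
  shows "ideal (carrier R \<inter> \<Inter>\<A>) R"
proof -
  have "ideal (\<Inter>(insert (carrier R) \<A>)) R"
    using assms oneideal by (intro i_Intersect) auto
  then show ?thesis by simp
qed

text \<open>Replaces annihilators in \<open>R Quot J\<close> by colon ideals, so that associated
  primes can be computed inside \<open>R\<close>.\<close>

lemma quot_annihilator_eq:
  assumes "ideal J R" "h \<in> carrier R"
  shows "quot_annihilator R J (J +> h) = {g \<in> carrier R. g \<otimes> h \<in> J}"
proof -
  interpret J: ideal J R by fact
  have "J +> x = J \<longleftrightarrow> x \<in> J" if "x \<in> carrier R" for x
    using that J.a_rcos_const J.a_rcos_self by blast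
  then show ?thesis
    using assms(2) J.rcoset_mult_add[of _ h]
    by (auto simp: quot_annihilator_def FactRing_def)
qed

text \<open>For \<open>J\<close> the intersection, the colon ideal of \<open>J\<close> by
  \<open>h\<close> is the intersection of the members that avoid \<open>h\<close>. If it is prime,
  it contains one of these members and so equals it. Conversely, an \<open>h\<close> lying in every
  member except \<open>P\<close> has colon ideal \<open>P\<close>.\<close>

lemma quot_Ass_Inter_antichain:
  assumes fin: "finite \<A>" and pr: "\<And>P. P \<in> \<A> \<Longrightarrow> primeideal P R"
    and anti: "\<And>P Q. P \<in> \<A> \<Longrightarrow> Q \<in> \<A> \<Longrightarrow> P \<subseteq> Q \<Longrightarrow> P = Q"
  shows "quot_Ass R (carrier R \<inter> \<Inter>\<A>) = \<A>"
proof
  define J where "J = carrier R \<inter> \<Inter>\<A>"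
  have memJ: "x \<in> J \<longleftrightarrow> x \<in> carrier R \<and> (\<forall>Q\<in>\<A>. x \<in> Q)" for x by (auto simp: J_def)
  have idl: "\<And>P. P \<in> \<A> \<Longrightarrow> ideal P R" using pr primeideal.axioms(1) by auto
  have J: "ideal J R" unfolding J_def by (rule ideal_carrier_Inter[OF idl])
  have carr: "carrier (R Quot J) = {J +> h | h. h \<in> carrier R}"
    by (auto simp: FactRing_def A_RCOSETS_def')
  show "quot_Ass R (carrier R \<inter> \<Inter>\<A>) \<subseteq> \<A>"
  proof
    fix P assume "P \<in> quot_Ass R (carrier R \<inter> \<Inter>\<A>)"
    then obtain x where P: "primeideal P R" "x \<in> carrier (R Quot J)" "P = quot_annihilator R J x"
      unfolding quot_Ass_def J_def by blast
    then obtain h where h: "h \<in> carrier R" "x = J +> h" unfolding carr by blast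
    let ?B = "{Q \<in> \<A>. h \<notin> Q}"
    have P': "P = {g \<in> carrier R. g \<otimes> h \<in> J}"
      unfolding P(3) h(2) by (rule quot_annihilator_eq[OF J h(1)])
    \<comment> \<open>A member containing \<open>h\<close> imposes no condition on \<open>g\<close>;
      for a member avoiding \<open>h\<close>, primeness turns \<open>g \<otimes> h \<in> Q\<close>
      into \<open>g \<in> Q\<close>.\<close>
    have eq: "P = carrier R \<inter> \<Inter>?B"
    proof (intro equalityI subsetI)
      fix g assume "g \<in> P"
      then have g: "g \<in> carrier R" "\<forall>Q\<in>\<A>. g \<otimes> h \<in> Q" unfolding P' memJ by blast+
      have "g \<in> Q" if "Q \<in> ?B" for Q
        using primeideal.I_prime[OF pr[of Q] g(1) h(1)] g(2) that by blast
      then show "g \<in> carrier R \<inter> \<Inter>?B" using g(1) by blast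
    next
      fix g assume g: "g \<in> carrier R \<inter> \<Inter>?B"
      have "g \<otimes> h \<in> Q" if "Q \<in> \<A>" for Q
        using g h that ideal.I_l_closed[OF idl[OF that]] ideal.I_r_closed[OF idl[OF that]]
        by (cases "h \<in> Q") blast+
      then show "g \<in> P" unfolding P' memJ using g h(1) by blast
    qed
    have "finite ?B" using fin by simp
    then have "\<exists>Q\<in>?B. Q \<subseteq> P"
      by (rule primeideal_contains_member_of_Inter) (use idl P(1) eq in blast)+
    then obtain Q where "Q \<in> \<A>" "h \<notin> Q" "Q \<subseteq> P" by blast
    moreover from this have "P \<subseteq> Q" unfolding eq by blast
    ultimately show "P \<in> \<A>" by (metis subset_antisym)
  qed
  show "\<A> \<subseteq> quot_Ass R (carrier R \<inter> \<Inter>\<A>)"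
  proof
    fix P assume P: "P \<in> \<A>"
    \<comment> \<open>This is where the antichain condition enters: otherwise some other member
      would lie inside \<open>P\<close>.\<close>
    have "\<not> carrier R \<inter> \<Inter>(\<A> - {P}) \<subseteq> P"
    proof
      assume "carrier R \<inter> \<Inter>(\<A> - {P}) \<subseteq> P"
      then have "\<exists>Q\<in>\<A> - {P}. Q \<subseteq> P"
        using fin idl by (intro primeideal_contains_member_of_Inter pr[OF P]) auto
      then show False using anti P by blast
    qed
    then obtain h where h: "h \<in> carrier R" "h \<in> \<Inter>(\<A> - {P})" "h \<notin> P" by blast
    have "P = {g \<in> carrier R. g \<otimes> h \<in> J}"
    proof (intro equalityI subsetI)
      fix g assume g: "g \<in> P"
      have gc: "g \<in> carrier R" using ideal.Icarr[OF idl[OF P] g] .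
      have "g \<otimes> h \<in> Q" if "Q \<in> \<A>" for Q
      proof (cases "Q = P")
        case True
        then show ?thesis using ideal.I_r_closed[OF idl[OF P] g h(1)] by simp
      next
        case False
        then show ?thesis using ideal.I_l_closed[OF idl[OF that] _ gc] h(2) that by blast
      qed
      then show "g \<in> {g \<in> carrier R. g \<otimes> h \<in> J}" using gc h(1) memJ by blast
    next
      fix g assume "g \<in> {g \<in> carrier R. g \<otimes> h \<in> J}"
      then have "g \<in> carrier R" "g \<otimes> h \<in> P" using P memJ by blast+
      then show "g \<in> P" using primeideal.I_prime[OF pr[OF P] _ h(1)] h(3) by blast
    qed
    then have "P = quot_annihilator R J (J +> h)" using quot_annihilator_eq[OF J h(1)] by simp
    moreover have "J +> h \<in> carrier (R Quot J)" unfolding carr using h(1) by blast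
    ultimately show "P \<in> quot_Ass R (carrier R \<inter> \<Inter>\<A>)"
      unfolding quot_Ass_def J_def[symmetric] using pr[OF P] by blast
  qed
qed

end

section \<open>Heights of primes and of intersections of primes\<close>

lemma prime_height_mono:
  assumes "primeideal Q R" "Q \<subseteq> P" "primeideal P R"
  shows "prime_height R Q \<le> prime_height R P"
proof (cases "Q = P")
  case False
  show ?thesis unfolding prime_height_def
  proof (rule Sup_least)
    fix x assume "x \<in> {enat m |m. \<exists>C. (\<forall>i\<le>m. primeideal (C i) R) \<and> (\<forall>i<m. C i \<subset> C (Suc i)) \<and> C m = Q}"
    then obtain m C where C: "x = enat m" "\<forall>i\<le>m. primeideal (C i) R" "\<forall>i<m. C i \<subset> C (Suc i)" "C m = Q"
      by auto
    \<comment> \<open>A chain ending at \<open>Q\<close> is prolonged by \<open>P\<close>, so in the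
      strict case the length even grows by one.\<close>
    have "\<exists>C'. (\<forall>i\<le>Suc m. primeideal (C' i) R) \<and> (\<forall>i<Suc m. C' i \<subset> C' (Suc i)) \<and> C' (Suc m) = P"
      using C assms False by (intro exI[of _ "C(Suc m := P)"]) (auto simp: le_Suc_eq less_Suc_eq)
    then have "enat (Suc m) \<le> Sup {enat m |m. \<exists>C. (\<forall>i\<le>m. primeideal (C i) R) \<and> (\<forall>i<m. C i \<subset> C (Suc i)) \<and> C m = P}"
      by (intro Sup_upper) blast
    then show "x \<le> Sup {enat m |m. \<exists>C. (\<forall>i\<le>m. primeideal (C i) R) \<and> (\<forall>i<m. C i \<subset> C (Suc i)) \<and> C m = P}"
      using C(1) by (meson enat_ord_simps(1) le_Suc_eq order_trans order_refl)
  qed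
qed simp

text \<open>Every prime over the intersection contains some member and is therefore at least as
  high; the members themselves attain \<open>h\<close>.\<close>

lemma (in cring) ideal_height_Inter:
  assumes fin: "finite \<A>" and ne: "\<A> \<noteq> {}" and pr: "\<And>P. P \<in> \<A> \<Longrightarrow> primeideal P R"
    and ht: "\<And>P. P \<in> \<A> \<Longrightarrow> prime_height R P = h"
  shows "ideal_height R (\<Inter>\<A>) = h"
proof (rule antisym)
  obtain P where "P \<in> \<A>" using ne by auto
  then show "ideal_height R (\<Inter>\<A>) \<le> h"
    unfolding ideal_height_def using pr ht by (intro Inf_lower) force
  show "h \<le> ideal_height R (\<Inter>\<A>)"
    unfolding ideal_height_def
  proof (rule Inf_greatest, clarify)
    fix P assume P: "primeideal P R" "\<Inter>\<A> \<subseteq> P"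
    then obtain Q where Q: "Q \<in> \<A>" "Q \<subseteq> P"
      using primeideal_contains_member_of_Inter[OF fin _ P(1)] pr primeideal.axioms(1) by blast
    then show "h \<le> prime_height R P"
      using prime_height_mono[OF pr[OF Q(1)] Q(2) P(1)] ht by simp
  qed
qed

section \<open>Monomial ideals in the polynomial ring\<close>

abbreviation keys :: "('a \<Rightarrow>\<^sub>0 'b::zero) \<Rightarrow> 'a set" where "keys \<equiv> Poly_Mapping.keys"
abbreviation lookup :: "('a \<Rightarrow>\<^sub>0 'b::zero) \<Rightarrow> 'a \<Rightarrow> 'b" where "lookup \<equiv> Poly_Mapping.lookup"
abbreviation single :: "'a \<Rightarrow> 'b \<Rightarrow> 'a \<Rightarrow>\<^sub>0 'b::zero" where "single \<equiv> Poly_Mapping.single"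

lemma keys_plus_nat: "keys (a + b :: 'a \<Rightarrow>\<^sub>0 nat) = keys a \<union> keys b"
  by (auto simp: in_keys_iff lookup_add)

lemma in_keys_timesE:
  fixes p q :: "'a::comm_monoid_add \<Rightarrow>\<^sub>0 'b::comm_semiring_1"
  assumes "m \<in> keys (p * q)"
  obtains a b where "a \<in> keys p" "b \<in> keys q" "m = a + b"
  using keys_mult[of p q] assms by auto

lemma poly_mapping_sum_keys: "p = (\<Sum>m\<in>keys p. single m (lookup p m))"
proof (rule poly_mapping_eqI)
  fix k
  have "lookup (\<Sum>m\<in>keys p. single m (lookup p m)) k = (\<Sum>m\<in>keys p. if k = m then lookup p k else 0)"
    by (auto simp: lookup_sum lookup_single when_def intro!: sum.cong)
  then show "lookup p k = lookup (\<Sum>m\<in>keys p. single m (lookup p m)) k"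
    by (auto simp: in_keys_iff)
qed

lemma carrier_mpoly_ring: "carrier (mpoly_ring n) = {p. \<forall>m\<in>keys p. keys m \<subseteq> {1..n}}"
  and mult_mpoly_ring [simp]: "x \<otimes>\<^bsub>mpoly_ring n\<^esub> y = x * y"
  and add_mpoly_ring [simp]: "x \<oplus>\<^bsub>mpoly_ring n\<^esub> y = x + y"
  and zero_mpoly_ring [simp]: "\<zero>\<^bsub>mpoly_ring n\<^esub> = 0"
  and one_mpoly_ring [simp]: "\<one>\<^bsub>mpoly_ring n\<^esub> = 1"
  by (auto simp: mpoly_ring_def ring_of_type_algebra_def)

lemma mpoly_zero_closed: "0 \<in> carrier (mpoly_ring n)"
  and mpoly_one_closed: "1 \<in> carrier (mpoly_ring n)"
  and mpoly_add_closed: "p \<in> carrier (mpoly_ring n) \<Longrightarrow> q \<in> carrier (mpoly_ring n) \<Longrightarrow> p + q \<in> carrier (mpoly_ring n)"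
  and mpoly_uminus_closed: "p \<in> carrier (mpoly_ring n) \<Longrightarrow> - p \<in> carrier (mpoly_ring n)"
  using keys_add[of p q] by (auto simp: carrier_mpoly_ring in_keys_iff)

lemma mpoly_mult_closed:
  "p \<in> carrier (mpoly_ring n) \<Longrightarrow> q \<in> carrier (mpoly_ring n) \<Longrightarrow> p * q \<in> carrier (mpoly_ring n)"
  unfolding carrier_mpoly_ring mem_Collect_eq by (metis in_keys_timesE keys_plus_nat Un_least)

lemma mpoly_single_closed:
  "keys m \<subseteq> {1..n} \<Longrightarrow> single m c \<in> carrier (mpoly_ring n)"
  by (auto simp: carrier_mpoly_ring split: if_splits)

lemmas mpoly_closed = mpoly_zero_closed mpoly_one_closed mpoly_add_closed mpoly_uminus_closed
  mpoly_mult_closed mpoly_single_closed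

lemma cring_mpoly_ring: "cring (mpoly_ring n)"
proof (rule cringI)
  show "abelian_group (mpoly_ring n)"
    by (rule abelian_groupI)
      (auto simp: mpoly_closed ac_simps intro!: bexI[of _ "- x" for x])
  show "comm_monoid (mpoly_ring n)"
    by (rule comm_monoidI) (auto simp: mpoly_closed ac_simps)
qed (auto simp: algebra_simps)

lemma ideal_mpolyI:
  assumes "I \<subseteq> carrier (mpoly_ring n)" "0 \<in> I" "\<And>a b. a \<in> I \<Longrightarrow> b \<in> I \<Longrightarrow> a + b \<in> I"
    "\<And>a x. a \<in> I \<Longrightarrow> x \<in> carrier (mpoly_ring n) \<Longrightarrow> x * a \<in> I"
  shows "ideal I (mpoly_ring n)"
proof -
  interpret R: cring "mpoly_ring n" by (rule cring_mpoly_ring)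
  have inv: "\<ominus>\<^bsub>mpoly_ring n\<^esub> a \<in> I" if "a \<in> I" for a
  proof -
    have a: "a \<in> carrier (mpoly_ring n)" using that assms by auto
    have "\<ominus>\<^bsub>mpoly_ring n\<^esub> a = (- 1) * a"
      using a by (intro R.minus_equality) (auto intro: mpoly_closed)
    then show ?thesis using assms(4)[OF that, of "- 1"] by (simp add: mpoly_closed)
  qed
  show ?thesis
  proof (rule idealI)
    show "subgroup I (add_monoid (mpoly_ring n))"
      using assms inv unfolding a_inv_def by (intro subgroup.intro) simp_all
  qed (use assms in \<open>simp_all add: R.ring_axioms mult.commute\<close>)
qed

lemma ideal_mpolyD:
  assumes "ideal I (mpoly_ring n)"
  shows "I \<subseteq> carrier (mpoly_ring n)" "0 \<in> I" "\<And>a b. a \<in> I \<Longrightarrow> b \<in> I \<Longrightarrow> a + b \<in> I"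
    "\<And>a x. a \<in> I \<Longrightarrow> x \<in> carrier (mpoly_ring n) \<Longrightarrow> x * a \<in> I"
proof -
  interpret ideal I "mpoly_ring n" by fact
  show "I \<subseteq> carrier (mpoly_ring n)" "0 \<in> I" "\<And>a b. a \<in> I \<Longrightarrow> b \<in> I \<Longrightarrow> a + b \<in> I"
    "\<And>a x. a \<in> I \<Longrightarrow> x \<in> carrier (mpoly_ring n) \<Longrightarrow> x * a \<in> I"
    using a_subset additive_subgroup.zero_closed[OF additive_subgroup_axioms]
      additive_subgroup.a_closed[OF additive_subgroup_axioms] I_l_closed by auto
qed

lemma ideal_mpoly_sum:
  assumes "ideal I (mpoly_ring n)" "\<And>i. i \<in> A \<Longrightarrow> f i \<in> I"
  shows "sum f A \<in> I"
  using assms(2) by (induction A rule: infinite_finite_induct) (auto simp: ideal_mpolyD[OF assms(1)])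

lemma mpoly_monomial_closed: "keys m \<subseteq> {1..n} \<Longrightarrow> mpoly_monomial m \<in> carrier (mpoly_ring n)"
  by (simp add: mpoly_monomial_def mpoly_single_closed)

lemma mpoly_monomial_add: "mpoly_monomial (a + b) = mpoly_monomial a * mpoly_monomial b"
  by (simp add: mpoly_monomial_def mult_single)

lemma keys_mpoly_monomial [simp]: "keys (mpoly_monomial m :: 'k::field mpoly) = {m}"
  by (simp add: mpoly_monomial_def)

text \<open>The right-hand side is an ideal containing the generators, and each term of such a
  polynomial is a multiple of one generator. Membership in a monomial ideal thus becomes a
  divisibility condition on exponents, tested term by term.\<close>

lemma genideal_monomials:
  fixes M :: "(nat \<Rightarrow>\<^sub>0 nat) set"
  assumes M: "\<And>s. s \<in> M \<Longrightarrow> keys s \<subseteq> {1..n}"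
  shows "Idl\<^bsub>mpoly_ring n\<^esub> (mpoly_monomial ` M) =
    {p :: 'k::field mpoly. p \<in> carrier (mpoly_ring n) \<and> (\<forall>m\<in>keys p. \<exists>s\<in>M. \<exists>t. m = s + t)}" (is "?L = ?R")
proof
  interpret R: cring "mpoly_ring n :: 'k mpoly ring" by (rule cring_mpoly_ring)
  have sub: "mpoly_monomial ` M \<subseteq> carrier (mpoly_ring n :: 'k mpoly ring)"
    using M by (blast intro: mpoly_monomial_closed)
  have L: "ideal ?L (mpoly_ring n)" by (rule R.genideal_ideal[OF sub])
  show "?R \<subseteq> ?L"
  proof
    fix p assume p: "p \<in> ?R"
    have "single m (lookup p m) \<in> ?L" if m: "m \<in> keys p" for m
    proof -
      obtain s t where st: "s \<in> M" "m = s + t" using p m by blast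
      have "keys m \<subseteq> {1..n}" using p m unfolding carrier_mpoly_ring by blast
      \<comment> \<open>Natural exponents cannot cancel, so the cofactor involves only variables of
        the ring.\<close>
      then have "keys t \<subseteq> {1..n}" unfolding st(2) keys_plus_nat by simp
      then have "single t (lookup p m) * mpoly_monomial s \<in> ?L"
        using st R.genideal_self[OF sub] by (intro ideal_mpolyD(4)[OF L]) (auto simp: mpoly_closed)
      then show ?thesis using st by (simp add: mpoly_monomial_def mult_single add.commute)
    qed
    then have "(\<Sum>m\<in>keys p. single m (lookup p m)) \<in> ?L" by (rule ideal_mpoly_sum[OF L])
    then show "p \<in> ?L" using poly_mapping_sum_keys[of p] by simp
  qed
  have "ideal ?R (mpoly_ring n)"
  proof (rule ideal_mpolyI)
    fix a b assume "a \<in> ?R" "b \<in> ?R"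
    then show "a + b \<in> ?R" using keys_add[of a b] by (fastforce simp: mpoly_closed)
  next
    fix a x :: "'k mpoly" assume a: "a \<in> ?R" and x: "x \<in> carrier (mpoly_ring n)"
    have "\<exists>s\<in>M. \<exists>t. m = s + t" if m: "m \<in> keys (x * a)" for m
    proof -
      obtain u v where uv: "u \<in> keys x" "v \<in> keys a" "m = u + v" using m by (rule in_keys_timesE)
      then obtain s t where "s \<in> M" "v = s + t" using a by blast
      then show ?thesis using uv by (intro bexI[of _ s] exI[of _ "t + u"]) (auto simp: ac_simps)
    qed
    then show "x * a \<in> ?R" using a x by (simp add: mpoly_closed)
  qed (auto simp: mpoly_closed)
  then show "?L \<subseteq> ?R"
  proof (rule R.genideal_minimal)
    show "mpoly_monomial ` M \<subseteq> ?R"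
      using sub by (auto intro!: bexI exI[of _ "0 :: nat \<Rightarrow>\<^sub>0 nat"])
  qed
qed

lemma var_ideal_eq:
  assumes "F \<subseteq> {1..n}"
  shows "var_ideal n F = {p :: 'k::field mpoly. p \<in> carrier (mpoly_ring n) \<and> (\<forall>m\<in>keys p. keys m \<inter> F \<noteq> {})}"
proof -
  have "(\<exists>i\<in>F. \<exists>t. m = single i 1 + t) \<longleftrightarrow> keys m \<inter> F \<noteq> {}" for m :: "nat \<Rightarrow>\<^sub>0 nat"
  proof
    assume "keys m \<inter> F \<noteq> {}"
    then obtain i where i: "i \<in> F" "i \<in> keys m" by auto
    have "m = single i 1 + (m - single i 1)"
      using i(2) by (intro poly_mapping_eqI)
        (auto simp: lookup_add lookup_minus lookup_single when_def in_keys_iff)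
    then show "\<exists>i\<in>F. \<exists>t. m = single i 1 + t" using i by blast
  qed (auto simp: keys_plus_nat)
  moreover have "(mpoly_var ` F :: 'k mpoly set) = mpoly_monomial ` (\<lambda>i. single i 1) ` F"
    by (auto simp: mpoly_var_def)
  moreover have "Idl\<^bsub>mpoly_ring n\<^esub> (mpoly_monomial ` (\<lambda>i. single i 1) ` F) =
      {p :: 'k mpoly. p \<in> carrier (mpoly_ring n) \<and>
        (\<forall>m\<in>keys p. \<exists>s\<in>(\<lambda>i. single i 1) ` F. \<exists>t. m = s + t)}"
    using assms by (intro genideal_monomials) auto
  ultimately show ?thesis
    unfolding var_ideal_def by (simp only: bex_simps)
qed

text \<open>Modulo the ideal every polynomial is represented by its part free of the variables in
  \<open>F\<close>. Such parts are closed under multiplication, meet the ideal only in 0 and have no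
  zero divisors.\<close>

lemma primeideal_var_ideal:
  assumes F: "F \<subseteq> {1..n}"
  shows "primeideal (var_ideal n F :: 'k::field mpoly set) (mpoly_ring n)"
proof -
  let ?R = "mpoly_ring n :: 'k mpoly ring" and ?P = "var_ideal n F :: 'k mpoly set"
  interpret R: cring ?R by (rule cring_mpoly_ring)
  have P: "ideal ?P ?R" unfolding var_ideal_def
    using F by (intro R.genideal_ideal) (auto simp: mpoly_var_def intro!: mpoly_monomial_closed)
  note PD = ideal_mpolyD[OF P]
  \<comment> \<open>Splits \<open>p\<close> by terms: \<open>p0\<close> collects those without
    variables from \<open>F\<close>, \<open>p1\<close> the others.\<close>
  have dec: "\<exists>p0 p1. p = p0 + p1 \<and> p1 \<in> ?P \<and> p0 \<in> carrier ?R \<and> (\<forall>m\<in>keys p0. keys m \<inter> F = {})"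
    if p: "p \<in> carrier ?R" for p
  proof -
    let ?K = "{m \<in> keys p. keys m \<inter> F = {}}" and ?K' = "{m \<in> keys p. keys m \<inter> F \<noteq> {}}"
    let ?s = "\<lambda>K. \<Sum>m\<in>K. single m (lookup p m)"
    have ks: "keys (?s K) \<subseteq> K" for K
      using keys_sum[of "\<lambda>m. single m (lookup p m)" K] by (auto split: if_splits)
    have "p = ?s (?K \<union> ?K')" using poly_mapping_sum_keys[of p] by (simp add: Un_def) (metis (mono_tags, lifting) Collect_cong Collect_mem_eq)
    also have "\<dots> = ?s ?K + ?s ?K'" by (intro sum.union_disjoint) auto
    finally have "p = ?s ?K + ?s ?K'" .
    moreover have "?s ?K' \<in> ?P" using ks[of ?K'] p by (auto simp: var_ideal_eq[OF F] carrier_mpoly_ring)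
    moreover have "?s ?K \<in> carrier ?R" "\<forall>m\<in>keys (?s ?K). keys m \<inter> F = {}"
      using ks[of ?K] p by (auto simp: carrier_mpoly_ring)
    ultimately show ?thesis by blast
  qed
  show ?thesis
  proof (rule primeidealI[OF P R.is_cring])
    show "carrier ?R \<noteq> ?P"
      using mpoly_one_closed[of n] by (force simp: var_ideal_eq[OF F])
  next
    fix a b assume ab: "a \<in> carrier ?R" "b \<in> carrier ?R" "a \<otimes>\<^bsub>?R\<^esub> b \<in> ?P"
    obtain a0 a1 where a: "a = a0 + a1" "a1 \<in> ?P" "a0 \<in> carrier ?R" "\<forall>m\<in>keys a0. keys m \<inter> F = {}"
      using dec ab by meson
    obtain b0 b1 where b: "b = b0 + b1" "b1 \<in> ?P" "b0 \<in> carrier ?R" "\<forall>m\<in>keys b0. keys m \<inter> F = {}"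
      using dec ab by meson
    have "a0 * b0 = a * b + ((- b0) * a1 + (- a) * b1)" unfolding a(1) b(1) by (simp add: algebra_simps)
    also have "\<dots> \<in> ?P"
      using ab a(2) b(2,3) PD(4)[OF a(2), of "- b0"] PD(4)[OF b(2), of "- a"]
      by (intro PD(3)) (simp_all add: mpoly_uminus_closed)
    finally have "a0 * b0 \<in> ?P" .
    moreover have "keys m \<inter> F = {}" if "m \<in> keys (a0 * b0)" for m
      using that a(4) b(4) by (elim in_keys_timesE) (auto simp: keys_plus_nat)
    ultimately have "keys (a0 * b0) = {}" by (auto simp: var_ideal_eq[OF F])
    then have "a0 = 0 \<or> b0 = 0" by simp
    then show "a \<in> ?P \<or> b \<in> ?P" using a(1,2) b(1,2) by auto
  qed
qed

section \<open>Symbolic powers and star configurations\<close>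

lemma monomial_in_var_ideal:
  assumes "F \<subseteq> {1..n}" "keys m \<subseteq> {1..n}" "keys m \<inter> F \<noteq> {}"
  shows "mpoly_monomial m \<in> var_ideal n F"
  using assms by (simp add: var_ideal_eq mpoly_monomial_closed)

lemma var_ideal_mono: "F \<subseteq> G \<Longrightarrow> G \<subseteq> {1..n} \<Longrightarrow> var_ideal n F \<subseteq> (var_ideal n G :: 'k::field mpoly set)"
  using var_ideal_eq[of F n, where 'k = 'k] var_ideal_eq[of G n, where 'k = 'k] by blast

lemma var_ideal_subsetD:
  assumes "F \<subseteq> {1..n}" "G \<subseteq> {1..n}" "var_ideal n F \<subseteq> (var_ideal n G :: 'k::field mpoly set)"
  shows "F \<subseteq> G"
proof
  fix i assume i: "i \<in> F"
  have "mpoly_monomial (single i 1) \<in> (var_ideal n F :: 'k mpoly set)"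
    using i assms by (intro monomial_in_var_ideal) auto
  then have "mpoly_monomial (single i 1) \<in> (var_ideal n G :: 'k mpoly set)" using assms(3) by blast
  then show "i \<in> G" using assms(2) by (simp add: var_ideal_eq)
qed

section \<open>Powers of ideals generated by variables\<close>

lemma ideals_set_pow_0: "P [^]\<^bsub>ideals_set R\<^esub> (0::nat) = carrier R"
  and ideals_set_pow_Suc: "P [^]\<^bsub>ideals_set R\<^esub> Suc l = (P [^]\<^bsub>ideals_set R\<^esub> l) \<cdot>\<^bsub>R\<^esub> P"
  by (simp_all add: nat_pow_def ideals_set_def)

text \<open>The degree in the variables of \<open>F\<close> is additive on products of monomials,
  and each factor from \<open>var_ideal n F\<close> contributes at least one; sums create no new
  monomials.\<close>

lemma keys_in_var_ideal_pow:
  fixes p :: "'k::field mpoly"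
  assumes F: "F \<subseteq> {1..n}" and "p \<in> var_ideal n F [^]\<^bsub>ideals_set (mpoly_ring n)\<^esub> l" "m \<in> keys p"
  shows "l \<le> (\<Sum>i\<in>F. lookup m i)"
  using assms(2,3)
proof (induction l arbitrary: p m)
  case (Suc l)
  have fin: "finite F" using F finite_subset by blast
  from Suc.prems have "p \<in> (var_ideal n F [^]\<^bsub>ideals_set (mpoly_ring n)\<^esub> l) \<cdot>\<^bsub>mpoly_ring n\<^esub> (var_ideal n F)"
    by (simp only: ideals_set_pow_Suc)
  then show ?case using Suc.prems(2)
  proof (induction arbitrary: m rule: ideal_prod.induct)
    case (prod f g)
    then obtain a b where ab: "a \<in> keys f" "b \<in> keys g" "m = a + b"
      by (auto elim: in_keys_timesE)
    have "l \<le> (\<Sum>i\<in>F. lookup a i)" using Suc.IH prod.hyps(1) ab(1) by blast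
    moreover have "keys b \<inter> F \<noteq> {}"
      using prod.hyps(2) ab(2) by (simp add: var_ideal_eq[OF F])
    then have "\<exists>i\<in>F. lookup b i \<noteq> 0" by (auto simp: in_keys_iff)
    then have "1 \<le> (\<Sum>i\<in>F. lookup b i)" using fin by (auto simp: Suc_le_eq intro!: Nat.gr0I)
    ultimately show ?case using ab by (simp add: lookup_add sum.distrib)
  next
    case (sum f g)
    then show ?case using keys_add[of f g] by auto
  qed
qed simp

definition sqfree_exponent_of :: "nat set \<Rightarrow> nat \<Rightarrow>\<^sub>0 nat" where
  "sqfree_exponent_of S = (\<Sum>i\<in>S. single i 1)"

lemma lookup_sqfree_exponent_of:
  "finite S \<Longrightarrow> lookup (sqfree_exponent_of S) i = (if i \<in> S then 1 else 0)"
  by (auto simp: sqfree_exponent_of_def lookup_sum lookup_single when_def)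

lemma keys_sqfree_exponent_of [simp]: "finite S \<Longrightarrow> keys (sqfree_exponent_of S) = S"
  by (auto simp: in_keys_iff lookup_sqfree_exponent_of split: if_splits)

lemma squarefree_exponent_of [simp]: "finite S \<Longrightarrow> squarefree_exponent (sqfree_exponent_of S)"
  by (simp add: squarefree_exponent_def lookup_sqfree_exponent_of)

lemma lookup_squarefree_exponent:
  "squarefree_exponent m \<Longrightarrow> lookup m i = (if i \<in> keys m then 1 else 0)"
  by (cases "lookup m i") (auto simp: squarefree_exponent_def in_keys_iff dest!: spec[of _ i])

lemma squarefree_exponent_eq:
  "squarefree_exponent m \<Longrightarrow> sqfree_exponent_of (keys m) = m"
  by (rule poly_mapping_eqI)
    (simp only: lookup_sqfree_exponent_of finite_keys lookup_squarefree_exponent)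

text \<open>One variable from \<open>S \<inter> F\<close> is split off for each factor of the
  power.\<close>

lemma sqfree_monomial_in_var_ideal_pow:
  assumes F: "F \<subseteq> {1..n}" and "S \<subseteq> {1..n}" "l \<le> card (S \<inter> F)"
  shows "(mpoly_monomial (sqfree_exponent_of S) :: 'k::field mpoly) \<in> var_ideal n F [^]\<^bsub>ideals_set (mpoly_ring n)\<^esub> l"
  using assms(2,3)
proof (induction l arbitrary: S)
  case 0
  then have "finite S" using finite_subset by blast
  then show ?case using 0 by (simp only: ideals_set_pow_0 mpoly_monomial_closed keys_sqfree_exponent_of)
next
  case (Suc l)
  have fin: "finite S" using Suc.prems finite_subset by blast
  obtain i where i: "i \<in> S" "i \<in> F"
    using Suc.prems(2) by (metis Int_iff card.empty ex_in_conv not_less_eq_eq zero_le)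
  have "(S - {i}) \<inter> F = S \<inter> F - {i}" by auto
  then have "(mpoly_monomial (sqfree_exponent_of (S - {i})) :: 'k mpoly) \<in> var_ideal n F [^]\<^bsub>ideals_set (mpoly_ring n)\<^esub> l"
    using Suc.prems i fin by (intro Suc.IH) auto
  moreover have "(mpoly_monomial (single i 1) :: 'k mpoly) \<in> var_ideal n F"
    using i F by (intro monomial_in_var_ideal) auto
  ultimately have "mpoly_monomial (sqfree_exponent_of (S - {i})) \<otimes>\<^bsub>mpoly_ring n\<^esub> (mpoly_monomial (single i 1) :: 'k mpoly)
      \<in> var_ideal n F [^]\<^bsub>ideals_set (mpoly_ring n)\<^esub> Suc l"
    unfolding ideals_set_pow_Suc by (rule ideal_prod.prod)
  moreover have "sqfree_exponent_of S = sqfree_exponent_of (S - {i}) + single i 1"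
    using i fin by (simp add: sqfree_exponent_of_def sum.remove[of S i] add.commute)
  ultimately show ?case by (simp add: mpoly_monomial_add)
qed

lemma sqfree_monomial_in_var_ideal_pow_iff:
  assumes F: "F \<subseteq> {1..n}" and m: "squarefree_exponent m" "keys m \<subseteq> {1..n}"
  shows "(mpoly_monomial m :: 'k::field mpoly) \<in> var_ideal n F [^]\<^bsub>ideals_set (mpoly_ring n)\<^esub> l
    \<longleftrightarrow> l \<le> card (keys m \<inter> F)"
proof -
  have fin: "finite F" using F finite_subset by blast
  have "(\<Sum>i\<in>F. lookup m i) = (\<Sum>i\<in>F. if i \<in> keys m then 1 else 0)"
    by (intro sum.cong refl lookup_squarefree_exponent m(1))
  also have "\<dots> = card (keys m \<inter> F)" using fin by (simp add: sum.If_cases Int_commute)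
  finally have "(\<Sum>i\<in>F. lookup m i) = card (keys m \<inter> F)" .
  then show ?thesis
    using keys_in_var_ideal_pow[OF F, of "mpoly_monomial m :: 'k mpoly" l m]
      sqfree_monomial_in_var_ideal_pow[OF F m(2), of l, where 'k='k]
    unfolding squarefree_exponent_eq[OF m(1)] by auto
qed

text \<open>Inclusions between variable ideals mirror inclusions between their index sets, so the
  antichain \<open>\<B>\<close> gives an antichain of primes, which is then exactly the set of
  associated primes.\<close>

lemma symbolic_power_Inter_var_ideals:
  assumes "finite \<B>" and B: "\<And>F. F \<in> \<B> \<Longrightarrow> F \<subseteq> {1..n}"
    and anti: "\<And>F G. F \<in> \<B> \<Longrightarrow> G \<in> \<B> \<Longrightarrow> F \<subseteq> G \<Longrightarrow> F = G" and ne: "\<B> \<noteq> {}"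
  shows "symbolic_power (mpoly_ring n) (\<Inter>F\<in>\<B>. var_ideal n F :: 'k::field mpoly set) l =
    carrier (mpoly_ring n) \<inter> (\<Inter>F\<in>\<B>. var_ideal n F [^]\<^bsub>ideals_set (mpoly_ring n)\<^esub> l)"
proof -
  let ?R = "mpoly_ring n :: 'k mpoly ring"
  interpret R: cring ?R by (rule cring_mpoly_ring)
  have "quot_Ass ?R (carrier ?R \<inter> \<Inter>(var_ideal n ` \<B>)) = var_ideal n ` \<B>"
  proof (rule R.quot_Ass_Inter_antichain)
    fix P Q assume "P \<in> var_ideal n ` \<B>" "Q \<in> var_ideal n ` \<B>" "P \<subseteq> (Q :: 'k mpoly set)"
    then obtain F G where "P = var_ideal n F" "Q = var_ideal n G" "F \<in> \<B>" "G \<in> \<B>" by auto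
    then show "P = Q" using \<open>P \<subseteq> Q\<close> var_ideal_subsetD[of F n G, where 'k='k] B anti by blast
  next
    fix P :: "'k mpoly set" assume "P \<in> var_ideal n ` \<B>"
    then show "primeideal P ?R" using B primeideal_var_ideal by blast
  qed (use assms in simp)
  moreover have "var_ideal n F \<subseteq> carrier ?R" if "F \<in> \<B>" for F
    using var_ideal_eq[OF B[OF that], where 'k='k] by blast
  then have "carrier ?R \<inter> \<Inter>(var_ideal n ` \<B>) = \<Inter>(var_ideal n ` \<B>)"
    using ne by blast
  ultimately show ?thesis by (simp add: symbolic_power_def)
qed

text \<open>The condition on a monomial sees only its support, and it passes to larger supports. A
  monomial satisfying it is thus a multiple of its squarefree part, which is one of the
  generators.\<close>

lemma SF_Inter_var_ideals:
  assumes "finite \<B>" and B: "\<And>F. F \<in> \<B> \<Longrightarrow> F \<subseteq> {1..n}"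
    and anti: "\<And>F G. F \<in> \<B> \<Longrightarrow> G \<in> \<B> \<Longrightarrow> F \<subseteq> G \<Longrightarrow> F = G" and ne: "\<B> \<noteq> {}"
  shows "SF n l (\<Inter>F\<in>\<B>. var_ideal n F) =
    {p :: 'k::field mpoly. p \<in> carrier (mpoly_ring n) \<and> (\<forall>m\<in>keys p. \<forall>F\<in>\<B>. l \<le> card (keys m \<inter> F))}"
proof -
  let ?M = "{m. squarefree_exponent m \<and> keys m \<subseteq> {1..n} \<and> (\<forall>F\<in>\<B>. l \<le> card (keys m \<inter> F))}"
  have gens: "{mpoly_monomial m :: 'k mpoly | m. squarefree_exponent m \<and>
      mpoly_monomial m \<in> symbolic_power (mpoly_ring n) (\<Inter>F\<in>\<B>. var_ideal n F :: 'k mpoly set) l} = mpoly_monomial ` ?M"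
  proof -
    have "mpoly_monomial m \<in> symbolic_power (mpoly_ring n) (\<Inter>F\<in>\<B>. var_ideal n F :: 'k mpoly set) l \<longleftrightarrow>
      keys m \<subseteq> {1..n} \<and> (\<forall>F\<in>\<B>. l \<le> card (keys m \<inter> F))" if "squarefree_exponent m" for m
    proof -
      have sp: "symbolic_power (mpoly_ring n) (\<Inter>F\<in>\<B>. var_ideal n F :: 'k mpoly set) l =
          carrier (mpoly_ring n) \<inter> (\<Inter>F\<in>\<B>. var_ideal n F [^]\<^bsub>ideals_set (mpoly_ring n)\<^esub> l)"
        by (rule symbolic_power_Inter_var_ideals[OF assms])
      have mc: "(mpoly_monomial m :: 'k mpoly) \<in> carrier (mpoly_ring n) \<longleftrightarrow> keys m \<subseteq> {1..n}"
        by (simp add: carrier_mpoly_ring)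
      have pw: "(mpoly_monomial m :: 'k mpoly) \<in> var_ideal n F [^]\<^bsub>ideals_set (mpoly_ring n)\<^esub> l \<longleftrightarrow>
          l \<le> card (keys m \<inter> F)" if "F \<in> \<B>" "keys m \<subseteq> {1..n}" for F
        using sqfree_monomial_in_var_ideal_pow_iff[OF B[OF that(1)] \<open>squarefree_exponent m\<close> that(2)] .
      show ?thesis
        unfolding sp Int_iff mc INT_iff by (intro conj_cong ball_cong refl pw)
    qed
    then show ?thesis unfolding setcompr_eq_image by (intro image_cong Collect_cong conj_cong refl)
  qed
  have SF: "SF n l (\<Inter>F\<in>\<B>. var_ideal n F :: 'k mpoly set) =
    {p. p \<in> carrier (mpoly_ring n) \<and> (\<forall>m\<in>keys p. \<exists>s\<in>?M. \<exists>t. m = s + t)}"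
    unfolding SF_def gens by (rule genideal_monomials) blast
  have iff: "(\<exists>s\<in>?M. \<exists>t. m = s + t) \<longleftrightarrow> (\<forall>F\<in>\<B>. l \<le> card (keys m \<inter> F))"
    if m: "keys m \<subseteq> {1..n}" for m
  proof
    assume "\<exists>s\<in>?M. \<exists>t. m = s + t"
    then obtain s t where st: "s \<in> ?M" "m = s + t" by blast
    have "card (keys s \<inter> F) \<le> card (keys m \<inter> F)" for F
      unfolding st keys_plus_nat by (intro card_mono) auto
    then show "\<forall>F\<in>\<B>. l \<le> card (keys m \<inter> F)" using st(1) order_trans by blast
  next
    assume r: "\<forall>F\<in>\<B>. l \<le> card (keys m \<inter> F)"
    \<comment> \<open>The truncated subtraction is exact because every exponent on the support of
      \<open>m\<close> is at least 1.\<close>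
    have eq: "m = sqfree_exponent_of (keys m) + (m - sqfree_exponent_of (keys m))"
      by (rule poly_mapping_eqI)
        (auto simp: lookup_add lookup_minus lookup_sqfree_exponent_of in_keys_iff)
    have "sqfree_exponent_of (keys m) \<in> ?M" using r m by simp
    then show "\<exists>s\<in>?M. \<exists>t. m = s + t" using eq by blast
  qed
  show ?thesis unfolding SF
    by (intro Collect_cong conj_cong ball_cong refl iff) (auto simp only: carrier_mpoly_ring)
qed

text \<open>A support meets every set of \<open>h\<close> variables iff its complement has fewer
  than \<open>h\<close> elements.\<close>

lemma star_configuration_eq:
  assumes "h \<le> n"
  shows "star_configuration n h =
    {p :: 'k::field mpoly. p \<in> carrier (mpoly_ring n) \<and> (\<forall>m\<in>keys p. n < card (keys m) + h)}"
proof -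
  have "(\<forall>F. F \<subseteq> {1..n} \<and> card F = h \<longrightarrow> K \<inter> F \<noteq> {}) \<longleftrightarrow> n < card K + h"
    if K: "K \<subseteq> {1..n}" for K
  proof -
    have fin: "finite K" using K finite_subset by blast
    have c: "card ({1..n} - K) = n - card K" "card K \<le> n"
      using K fin card_mono[OF _ K] by (simp_all add: card_Diff_subset)
    show ?thesis
    proof
      assume *: "\<forall>F. F \<subseteq> {1..n} \<and> card F = h \<longrightarrow> K \<inter> F \<noteq> {}"
      show "n < card K + h"
      proof (rule ccontr)
        assume "\<not> n < card K + h"
        then have "h \<le> card ({1..n} - K)" using c by simp
        then obtain F where "F \<subseteq> {1..n} - K" "card F = h"
          by (meson obtain_subset_with_card_n)
        then show False using * by blast
      qed
    next
      assume n: "n < card K + h"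
      show "\<forall>F. F \<subseteq> {1..n} \<and> card F = h \<longrightarrow> K \<inter> F \<noteq> {}"
      proof (intro allI impI notI)
        fix F assume F: "F \<subseteq> {1..n} \<and> card F = h" "K \<inter> F = {}"
        then have "card F \<le> card ({1..n} - K)" by (intro card_mono) auto
        then show False using n c F by simp
      qed
    qed
  qed
  then have iff: "(\<forall>F. F \<subseteq> {1..n} \<and> card F = h \<longrightarrow> keys m \<inter> F \<noteq> {}) \<longleftrightarrow> n < card (keys m) + h"
    if "keys m \<subseteq> {1..n}" for m :: "nat \<Rightarrow>\<^sub>0 nat" using that .
  have "(\<forall>F\<in>{F. F \<subseteq> {1..n} \<and> card F = h}. p \<in> var_ideal n F) \<longleftrightarrow> (\<forall>m\<in>keys p. n < card (keys m) + h)"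
    if p: "p \<in> carrier (mpoly_ring n)" for p :: "'k mpoly"
  proof -
    have "p \<in> var_ideal n F \<longleftrightarrow> (\<forall>m\<in>keys p. keys m \<inter> F \<noteq> {})" if "F \<subseteq> {1..n}" for F
      using p by (simp add: var_ideal_eq[OF that])
    then have "(\<forall>F\<in>{F. F \<subseteq> {1..n} \<and> card F = h}. p \<in> var_ideal n F) \<longleftrightarrow>
        (\<forall>m\<in>keys p. \<forall>F. F \<subseteq> {1..n} \<and> card F = h \<longrightarrow> keys m \<inter> F \<noteq> {})" by blast
    also have "\<dots> \<longleftrightarrow> (\<forall>m\<in>keys p. n < card (keys m) + h)"
      using p iff unfolding carrier_mpoly_ring by (intro ball_cong) blast+
    finally show ?thesis .
  qed
  then show ?thesis unfolding star_configuration_def by blast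
qed

section \<open>The height of an ideal generated by variables\<close>

text \<open>Adjoining the variables of \<open>F\<close> one at a time, from the zero ideal upwards,
  gives a strict chain of primes of length \<open>card F\<close>.\<close>

lemma prime_height_var_ideal_ge:
  assumes F: "F \<subseteq> {1..n}"
  shows "enat (card F) \<le> prime_height (mpoly_ring n) (var_ideal n F :: 'k::field mpoly set)"
proof -
  have "finite F" using F finite_subset by blast
  then obtain xs where xs: "set xs = F" "distinct xs" using finite_distinct_list by blast
  let ?C = "\<lambda>i. var_ideal n (set (take i xs)) :: 'k mpoly set"
  have sub: "set (take i xs) \<subseteq> {1..n}" for i using F xs(1) set_take_subset[of i xs] by blast
  have "?C i \<subset> ?C (Suc i)" if i: "i < card F" for i
  proof -
    have len: "i < length xs" using i xs distinct_card by fastforce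
    then have *: "set (take (Suc i) xs) = insert (xs ! i) (set (take i xs))"
      by (simp add: take_Suc_conv_app_nth)
    have "distinct (take (Suc i) xs)" using xs(2) by simp
    then have "xs ! i \<notin> set (take i xs)" using len by (simp add: take_Suc_conv_app_nth)
    then have "\<not> ?C (Suc i) \<subseteq> ?C i"
      using var_ideal_subsetD[OF sub sub, where 'k='k, of "Suc i" i] * by blast
    moreover have "?C i \<subseteq> ?C (Suc i)" unfolding * using sub[of "Suc i"] * by (intro var_ideal_mono subset_insertI) simp
    ultimately show ?thesis by blast
  qed
  moreover have "?C (card F) = var_ideal n F" using xs distinct_card by force
  moreover have "primeideal (?C i) (mpoly_ring n)" for i by (rule primeideal_var_ideal[OF sub])
  ultimately have "\<exists>C. (\<forall>i\<le>card F. primeideal (C i) (mpoly_ring n)) \<and> (\<forall>i<card F. C i \<subset> C (Suc i)) \<and>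
      C (card F) = (var_ideal n F :: 'k mpoly set)" by (intro exI[of _ ?C]) simp
  then show ?thesis unfolding prime_height_def by (intro Sup_upper) blast
qed

section \<open>Power products of elements picked along a chain of primes\<close>

definition list_monomial :: "'a::comm_monoid_mult list \<Rightarrow> nat list \<Rightarrow> 'a" where
  "list_monomial ys e = prod_list (map2 (^) ys e)"

lemma list_monomial_Nil [simp]: "list_monomial [] e = 1"
  and list_monomial_Cons [simp]: "list_monomial (y # ys) (t # e) = y ^ t * list_monomial ys e"
  by (simp_all add: list_monomial_def)

lemma mpoly_power_closed: "p \<in> carrier (mpoly_ring n) \<Longrightarrow> p ^ t \<in> carrier (mpoly_ring n)"
  by (induction t) (auto intro: mpoly_closed)

lemma mpoly_sum_closed: "(\<And>i. i \<in> A \<Longrightarrow> f i \<in> carrier (mpoly_ring n)) \<Longrightarrow> sum f A \<in> carrier (mpoly_ring n)"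
  by (induction A rule: infinite_finite_induct) (auto intro: mpoly_closed)

lemma list_monomial_closed:
  assumes "set ys \<subseteq> carrier (mpoly_ring n)"
  shows "list_monomial ys e \<in> carrier (mpoly_ring n)"
  using assms
proof (induction ys arbitrary: e)
  case (Cons y ys)
  then show ?case
    by (cases e) (auto simp: list_monomial_def[of _ "[]"] intro!: mpoly_closed mpoly_power_closed)
qed (simp add: mpoly_closed)

text \<open>Induction along the chain. If the sum lay in \<open>C 0\<close>, the factor
  \<open>y ^ t\<close> could be cancelled because \<open>y\<close> is outside the prime
  \<open>C 0\<close>. This puts \<open>Z + y * W\<close> into \<open>C 1\<close>, and
  \<open>y \<in> C 1\<close> leaves \<open>Z \<in> C 1\<close>. But \<open>Z\<close> is a
  combination of the same shape for the remaining chain, which starts at \<open>C 1\<close>.\<close>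

lemma list_monomial_combination_notin:
  fixes C :: "nat \<Rightarrow> 'k::field mpoly set"
  assumes "\<And>i. i \<le> length ys \<Longrightarrow> primeideal (C i) (mpoly_ring n)"
    and "\<And>i. i < length ys \<Longrightarrow> C i \<subseteq> C (Suc i)"
    and "\<And>i. i < length ys \<Longrightarrow> ys ! i \<in> C (Suc i) - C i"
    and "finite S" "S \<noteq> {}"
    and "\<And>e. e \<in> S \<Longrightarrow> length e = length ys \<and> a e \<in> carrier (mpoly_ring n) - C (length ys)"
  shows "(\<Sum>e\<in>S. a e * list_monomial ys e) \<notin> C 0"
  using assms
proof (induction ys arbitrary: C S a)
  case Nil
  then have "S = {[]}" by auto
  then show ?case using Nil.prems(6) by simp
next
  case (Cons y ys)
  note prems = Cons.prems
  have ideal: "ideal (C i) (mpoly_ring n)" if "i \<le> Suc (length ys)" for i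
    using prems(1)[of i] that primeideal.axioms(1) by auto
  have P0: "primeideal (C 0) (mpoly_ring n)" using prems(1)[of 0] by simp
  have y: "y \<in> C 1" "y \<notin> C 0" using prems(3)[of 0] by auto
  have yc: "y \<in> carrier (mpoly_ring n)" using ideal_mpolyD(1)[OF ideal[of 1]] y by auto
  have ysc: "set ys \<subseteq> carrier (mpoly_ring n)"
  proof
    fix z assume "z \<in> set ys"
    then obtain i where "i < length ys" "z = ys ! i" by (auto simp: in_set_conv_nth)
    then show "z \<in> carrier (mpoly_ring n)"
      using prems(3)[of "Suc i"] ideal_mpolyD(1)[OF ideal[of "Suc (Suc i)"]] by auto
  qed
  \<comment> \<open>\<open>t\<close> is the lowest power of \<open>y\<close>; \<open>Z\<close> collects its terms and the sum is \<open>y ^ t * (Z + y * W)\<close>.\<close>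
  define t where "t = Min (hd ` S)"
  define S0 where "S0 = {e \<in> S. hd e = t}"
  have t: "t \<le> hd e" if "e \<in> S" for e using that prems(4) by (simp add: t_def)
  have form: "e = hd e # tl e" "length (tl e) = length ys" if "e \<in> S" for e
    using prems(6)[OF that] by (cases e; simp)+
  have S0: "e = t # tl e" if "e \<in> S0" for e using form(1)[of e] that unfolding S0_def by simp
  have tlS0: "t # e \<in> S" if "e \<in> tl ` S0" for e
    using that S0 unfolding S0_def by (smt (verit, ccfv_threshold) imageE mem_Collect_eq)
  define W where "W = (\<Sum>e\<in>S - S0. a e * (y ^ (hd e - Suc t) * list_monomial ys (tl e)))"
  define Z where "Z = (\<Sum>e\<in>tl ` S0. a (t # e) * list_monomial ys e)"
  have Wc: "W \<in> carrier (mpoly_ring n)" unfolding W_def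
    using prems(6) by (intro mpoly_sum_closed mpoly_mult_closed mpoly_power_closed list_monomial_closed yc ysc) auto
  have Zc: "Z \<in> carrier (mpoly_ring n)" unfolding Z_def
    using prems(6)[OF tlS0] by (intro mpoly_sum_closed mpoly_mult_closed list_monomial_closed ysc) blast
  \<comment> \<open>All lists in \<open>S0\<close> begin with \<open>t\<close>, so their tails
    determine them and the sum can be reindexed to \<open>Z\<close>.\<close>
  have inj: "inj_on tl S0" using S0 unfolding inj_on_def by metis
  have "(\<Sum>e\<in>S0. a e * list_monomial (y # ys) e) = (\<Sum>e\<in>S0. y ^ t * (a (t # tl e) * list_monomial ys (tl e)))"
  proof (rule sum.cong)
    fix e assume "e \<in> S0"
    then have "e = t # tl e" by (rule S0)
    then show "a e * list_monomial (y # ys) e = y ^ t * (a (t # tl e) * list_monomial ys (tl e))"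
      by (metis list_monomial_Cons mult.left_commute)
  qed simp
  also have "\<dots> = y ^ t * Z" unfolding Z_def by (simp add: sum.reindex[OF inj] sum_distrib_left)
  finally have s0: "(\<Sum>e\<in>S0. a e * list_monomial (y # ys) e) = y ^ t * Z" .
  have "(\<Sum>e\<in>S - S0. a e * list_monomial (y # ys) e) =
      (\<Sum>e\<in>S - S0. y ^ t * (y * (a e * (y ^ (hd e - Suc t) * list_monomial ys (tl e)))))"
  proof (rule sum.cong)
    fix e assume e: "e \<in> S - S0"
    then have "Suc t \<le> hd e" using t[of e] unfolding S0_def by auto
    then have "y ^ hd e = y ^ t * (y * y ^ (hd e - Suc t))"
      by (metis power_Suc power_add le_add_diff_inverse mult.assoc power_Suc2)
    moreover have "list_monomial (y # ys) e = y ^ hd e * list_monomial ys (tl e)"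
      using form(1)[of e] e by (metis DiffD1 list_monomial_Cons)
    ultimately show "a e * list_monomial (y # ys) e =
        y ^ t * (y * (a e * (y ^ (hd e - Suc t) * list_monomial ys (tl e))))"
      by (simp only: ac_simps)
  qed simp
  also have "\<dots> = y ^ t * (y * W)" unfolding W_def by (simp add: sum_distrib_left)
  finally have s1: "(\<Sum>e\<in>S - S0. a e * list_monomial (y # ys) e) = y ^ t * (y * W)" .
  have "(\<Sum>e\<in>S. a e * list_monomial (y # ys) e) =
      (\<Sum>e\<in>S - S0. a e * list_monomial (y # ys) e) + (\<Sum>e\<in>S0. a e * list_monomial (y # ys) e)"
    using prems(4) by (intro sum.subset_diff) (auto simp: S0_def)
  then have split: "(\<Sum>e\<in>S. a e * list_monomial (y # ys) e) = y ^ t * (Z + y * W)"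
    unfolding s0 s1 by (simp add: algebra_simps)
  \<comment> \<open>The induction hypothesis for the shifted chain; its index set is nonempty
    because the minimum \<open>t\<close> is attained.\<close>
  have "Z \<notin> C (Suc 0)" unfolding Z_def
  proof (rule Cons.IH[of "\<lambda>i. C (Suc i)"])
    have "t \<in> hd ` S" unfolding t_def using prems(4,5) by (intro Min_in) auto
    then show "tl ` S0 \<noteq> {}" by (auto simp: S0_def)
    show "finite (tl ` S0)" using prems(4) by (simp add: S0_def)
  next
    fix e assume "e \<in> tl ` S0"
    then have "t # e \<in> S" by (rule tlS0)
    then show "length e = length ys \<and> a (t # e) \<in> carrier (mpoly_ring n) - C (Suc (length ys))"
      using prems(6)[of "t # e"] by simp
  next
    fix i assume "i \<le> length ys"
    then show "primeideal (C (Suc i)) (mpoly_ring n)" using prems(1)[of "Suc i"] by simp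
  next
    fix i assume "i < length ys"
    then show "C (Suc i) \<subseteq> C (Suc (Suc i))" "ys ! i \<in> C (Suc (Suc i)) - C (Suc i)"
      using prems(2,3)[of "Suc i"] by simp_all
  qed
  show ?case
  proof
    assume "(\<Sum>e\<in>S. a e * list_monomial (y # ys) e) \<in> C 0"
    then have *: "y ^ t * (Z + y * W) \<in> C 0" unfolding split .
    have ZW: "Z + y * W \<in> carrier (mpoly_ring n)" by (intro mpoly_closed Zc Wc yc)
    have cancel: "y ^ s * (Z + y * W) \<in> C 0 \<Longrightarrow> Z + y * W \<in> C 0" for s
    proof (induction s)
      case (Suc s)
      have "y * (y ^ s * (Z + y * W)) \<in> C 0" using Suc.prems by (simp add: mult.assoc)
      then have "y ^ s * (Z + y * W) \<in> C 0"
        using primeideal.I_prime[OF P0 yc, of "y ^ s * (Z + y * W)"] y(2)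
          mpoly_mult_closed[OF mpoly_power_closed[OF yc] ZW] by simp
      then show ?case by (rule Suc.IH)
    qed simp
    have "C 0 \<subseteq> C 1" using prems(2)[of 0] by simp
    then have "Z + y * W \<in> C 1" using cancel[OF *] by blast
    moreover have "(- W) * y \<in> C 1"
      using ideal_mpolyD(4)[OF ideal[of 1] y(1), of "- W"] Wc by (simp add: mpoly_uminus_closed)
    moreover have "ideal (C 1) (mpoly_ring n)" by (rule ideal) simp
    ultimately have "(Z + y * W) + (- W) * y \<in> C 1" using ideal_mpolyD(3) by blast
    then show False using \<open>Z \<notin> C (Suc 0)\<close> by (simp add: algebra_simps)
  qed
qed

section \<open>Linear algebra and counting of exponent vectors\<close>

lemma underdetermined_system:
  fixes a :: "'i \<Rightarrow> 't \<Rightarrow> 'k::field"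
  assumes "finite T" "finite I" "card T < card I"
  shows "\<exists>q. (\<exists>i\<in>I. q i \<noteq> 0) \<and> (\<forall>t\<in>T. (\<Sum>i\<in>I. q i * a i t) = 0)"
  using assms
proof (induction T arbitrary: I a rule: finite_induct)
  case empty
  then have "I \<noteq> {}" by auto
  then show ?case by (intro exI[of _ "\<lambda>_. 1"]) auto
next
  case (insert t T)
  show ?case
  proof (cases "\<exists>i\<in>I. a i t \<noteq> 0")
    case True
    then obtain j where j: "j \<in> I" "a j t \<noteq> 0" by blast
    let ?I = "I - {j}"
    \<comment> \<open>Gaussian elimination: equation \<open>t\<close> with pivot \<open>j\<close>
      removes the unknown \<open>j\<close> from the other equations.\<close>
    define b where "b i s = a i s - a i t / a j t * a j s" for i s
    have "card T < card ?I" using insert j by simp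
    then obtain q where q: "\<exists>i\<in>?I. q i \<noteq> 0" "\<forall>s\<in>T. (\<Sum>i\<in>?I. q i * b i s) = 0"
      using insert.IH[of ?I b] insert.prems by auto
    \<comment> \<open>Back substitution: the value at \<open>j\<close> is forced by equation
      \<open>t\<close>.\<close>
    define q' where "q' = q(j := - (\<Sum>i\<in>?I. q i * (a i t / a j t)))"
    have "(\<Sum>i\<in>I. q' i * a i s) = (\<Sum>i\<in>?I. q i * b i s)" for s
    proof -
      have "(\<Sum>i\<in>I. q' i * a i s) = q' j * a j s + (\<Sum>i\<in>?I. q' i * a i s)"
        using insert.prems j by (intro sum.remove) auto
      also have "(\<Sum>i\<in>?I. q' i * a i s) = (\<Sum>i\<in>?I. q i * a i s)"
        by (intro sum.cong) (auto simp: q'_def)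
      finally show ?thesis
        by (simp add: q'_def b_def right_diff_distrib sum_subtractf sum_distrib_right mult.assoc)
    qed
    moreover have "b i t = 0" for i using j by (simp add: b_def)
    moreover have "\<exists>i\<in>I. q' i \<noteq> 0" using q(1) by (auto simp: q'_def)
    ultimately show ?thesis using q(2) by (intro exI[of _ q']) auto
  next
    case False
    then show ?thesis using insert.IH[of I a] insert by auto
  qed
qed

definition exponent_box :: "'a set \<Rightarrow> nat \<Rightarrow> ('a \<Rightarrow>\<^sub>0 nat) set" where
  "exponent_box V B = {m. keys m \<subseteq> V \<and> (\<forall>i. lookup m i < B)}"

text \<open>Restricting to \<open>V\<close> identifies the box with the functions from
  \<open>V\<close> to \<open>{..<B}\<close>; the inverse extends a function by 0.\<close>

lemma exponent_box_finite_card: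
  assumes "finite V" "0 < B"
  shows "finite (exponent_box V B)" "card (exponent_box V B) = B ^ card V"
proof -
  have bij: "bij_betw (\<lambda>m. restrict (lookup m) V) (exponent_box V B) (PiE V (\<lambda>_. {..<B}))"
  proof (rule bij_betw_imageI)
    show "inj_on (\<lambda>m. restrict (lookup m) V) (exponent_box V B)"
    proof (rule inj_onI, rule poly_mapping_eqI)
      fix m m' i
      assume *: "m \<in> exponent_box V B" "m' \<in> exponent_box V B" "restrict (lookup m) V = restrict (lookup m') V"
      show "lookup m i = lookup m' i"
      proof (cases "i \<in> V")
        case True
        then show ?thesis using *(3) by (metis restrict_apply')
      next
        case False
        then have "i \<notin> keys m" "i \<notin> keys m'" using * by (auto simp: exponent_box_def)
        then show ?thesis by (simp add: in_keys_iff)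
      qed
    qed
    show "(\<lambda>m. restrict (lookup m) V) ` exponent_box V B = PiE V (\<lambda>_. {..<B})"
    proof (intro equalityI subsetI)
      fix f assume f: "f \<in> PiE V (\<lambda>_. {..<B})"
      define m where "m = Abs_poly_mapping (\<lambda>i. if i \<in> V then f i else 0)"
      have "finite {i. (if i \<in> V then f i else 0) \<noteq> 0}"
        using assms(1) by (rule rev_finite_subset) auto
      then have m: "lookup m i = (if i \<in> V then f i else 0)" for i
        by (simp add: m_def)
      then have "m \<in> exponent_box V B" using f assms(2)
        by (auto simp: exponent_box_def in_keys_iff split: if_splits)
      moreover have "f = restrict (lookup m) V" using f by (auto simp: m fun_eq_iff PiE_def extensional_def)
      ultimately show "f \<in> (\<lambda>m. restrict (lookup m) V) ` exponent_box V B" by blast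
    qed (auto simp: exponent_box_def)
  qed
  have "finite (PiE V (\<lambda>_. {..<B}))" using assms(1) by (intro finite_PiE) auto
  then show "finite (exponent_box V B)" using bij_betw_finite[OF bij] by simp
  show "card (exponent_box V B) = B ^ card V"
    using bij_betw_same_card[OF bij] assms(1) by (simp add: card_PiE)
qed

lemma list_monomial_keys_bound:
  fixes ys :: "'k::field mpoly list"
  assumes "\<And>y u i. y \<in> set ys \<Longrightarrow> u \<in> keys y \<Longrightarrow> lookup u i \<le> d"
    and "length e = length ys" "u \<in> keys (list_monomial ys e)"
  shows "lookup u i \<le> d * sum_list e"
  using assms
proof (induction ys arbitrary: e u)
  case (Cons y ys)
  then obtain t e' where e: "e = t # e'" "length e' = length ys" by (cases e) auto
  have pw: "lookup w i \<le> d * s" if "w \<in> keys (y ^ s)" for w s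
    using that
  proof (induction s arbitrary: w)
    case (Suc s)
    then obtain a b where ab: "a \<in> keys y" "b \<in> keys (y ^ s)" "w = a + b"
      by (auto elim: in_keys_timesE)
    then show ?case using Suc.IH[of b] Cons.prems(1)[of y a i] by (simp add: lookup_add)
  qed simp
  obtain a b where ab: "a \<in> keys (y ^ t)" "b \<in> keys (list_monomial ys e')" "u = a + b"
    using Cons.prems(3) unfolding e by (auto elim: in_keys_timesE)
  have "lookup b i \<le> d * sum_list e'" using Cons.prems(1) ab(2) e(2) by (intro Cons.IH) auto
  then show ?case using pw[OF ab(1)] by (simp add: ab(3) e lookup_add algebra_simps)
qed simp

text \<open>A chain that is too long yields a relation among elements picked from its steps. Each of
  its nonzero coefficients involves only variables outside \<open>F\<close> and so avoids
  \<open>var_ideal n F\<close>. By \<open>list_monomial_combination_notin\<close> the relation would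
  then not lie in the bottom prime, yet it equals 0.\<close>

lemma prime_chain_to_var_ideal_le:
  fixes C :: "nat \<Rightarrow> 'k::field mpoly set"
  assumes F: "F \<subseteq> {1..n}"
    and prime: "\<And>i. i \<le> m \<Longrightarrow> primeideal (C i) (mpoly_ring n)"
    and strict: "\<And>i. i < m \<Longrightarrow> C i \<subset> C (Suc i)" and last: "C m = var_ideal n F"
  shows "m \<le> card F"
proof (rule ccontr)
  assume "\<not> m \<le> card F"
  define k where "k = Suc (card F)"
  have km: "k \<le> m" using \<open>\<not> m \<le> card F\<close> by (simp add: k_def)
  \<comment> \<open>The last \<open>card F + 1\<close> steps of the chain, still ending at
    \<open>var_ideal n F\<close>.\<close>
  define D where "D i = C (m - k + i)" for i
  have D: "primeideal (D i) (mpoly_ring n)" if "i \<le> k" for i using prime[of "m - k + i"] that km by (simp add: D_def)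
  have Dk: "D k = var_ideal n F" using km last by (simp add: D_def)
  have Dstrict: "D i \<subset> D (Suc i)" if "i < k" for i
    using strict[of "m - k + i"] that km by (simp add: D_def)
  then have "\<exists>y. y \<in> D (Suc i) - D i" if "i < k" for i using that by blast
  then obtain y where y: "y i \<in> D (Suc i) - D i" if "i < k" for i by metis
  define ys where "ys = map y [0..<k]"
  have len: "length ys = k" by (simp add: ys_def)
  have nth: "ys ! i \<in> D (Suc i) - D i" if "i < k" for i using y[OF that] that by (simp add: ys_def)
  have Dc: "D i \<subseteq> carrier (mpoly_ring n)" if "i \<le> k" for i
    using ideal_mpolyD(1) primeideal.axioms(1)[OF D[OF that]] by blast
  have ysc: "set ys \<subseteq> carrier (mpoly_ring n)"
  proof
    fix z assume "z \<in> set ys"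
    then obtain i where "i < k" "z = ys ! i" using len by (auto simp: in_set_conv_nth)
    then show "z \<in> carrier (mpoly_ring n)" using nth[of i] Dc[of "Suc i"] by auto
  qed
  have fF: "finite F" "card F \<le> n" using F finite_subset card_mono[OF _ F] by auto
  \<comment> \<open>A common bound for all exponents in the chosen elements; the inserted 0 covers
    the case that no variable occurs.\<close>
  define d where "d = Max (insert 0 ((\<lambda>(u, i). lookup u i) ` (SIGMA u:(\<Union>z\<in>set ys. keys z). keys u)))"
  have d: "lookup u i \<le> d" if "z \<in> set ys" "u \<in> keys z" for z u i
  proof (cases "i \<in> keys u")
    case True
    then show ?thesis unfolding d_def using that by (intro Max_ge) force+
  qed (simp add: in_keys_iff)
  \<comment> \<open>The \<open>N ^ (n + 1)\<close> products \<open>x\<^sup>u * ys\<^sup>e\<close> with entries of \<open>u\<close>, \<open>e\<close> below \<open>N\<close> and \<open>u\<close> supported outside \<open>F\<close>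
    live on only \<open>(N * K) ^ n\<close> monomials, which is fewer for this choice of \<open>N\<close>.\<close>
  define K where "K = k * d + 1"
  define N where "N = K ^ n + 1"
  define U where "U = exponent_box ({1..n} - F) N"
  define E where "E = {e. set e \<subseteq> {..<N} \<and> length e = k}"
  define T where "T = exponent_box {1..n} (N * K)"
  have U: "finite U" "card U = N ^ (n - card F)"
    using exponent_box_finite_card[of "{1..n} - F" N] F fF by (auto simp: U_def N_def card_Diff_subset)
  have T: "finite T" "card T = (N * K) ^ n"
    using exponent_box_finite_card[of "{1..n}" "N * K"] by (auto simp: T_def N_def K_def)
  have E: "finite E" "card E = N ^ k"
    using finite_lists_length_eq[of "{..<N}" k] card_lists_length_eq[of "{..<N}" k] by (auto simp: E_def)
  define v where "v = (\<lambda>(u, e). single u 1 * list_monomial ys e :: 'k mpoly)"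
  have vT: "keys (v (u, e)) \<subseteq> T" if "u \<in> U" "e \<in> E" for u e
  proof
    fix w assume w: "w \<in> keys (v (u, e))"
    then obtain b where b: "b \<in> keys (list_monomial ys e)" "w = u + b"
      by (auto simp: v_def elim!: in_keys_timesE)
    have "keys b \<subseteq> {1..n}" using list_monomial_closed[OF ysc, of e] b(1) unfolding carrier_mpoly_ring by blast
    then have "keys w \<subseteq> {1..n}" using that(1) b(2) by (auto simp: keys_plus_nat U_def exponent_box_def)
    \<comment> \<open>The factor \<open>u\<close> contributes less than \<open>N\<close>, the power
      product at most \<open>d * (k * N)\<close>, and together this stays below
      \<open>N * K\<close>.\<close>
    moreover have "lookup w i < N * K" for i
    proof -
      have "x \<le> N" if "x \<in> set e" for x using that \<open>e \<in> E\<close> by (auto simp: E_def intro: less_imp_le)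
      then have "sum_list e \<le> k * N" using sum_list_mono[of e "\<lambda>x. x" "\<lambda>_. N"] that(2)
        by (auto simp: E_def sum_list_triv)
      then have "d * sum_list e \<le> d * (k * N)" by (rule mult_le_mono2)
      moreover have "lookup b i \<le> d * sum_list e"
        using that(2) b(1) d by (intro list_monomial_keys_bound) (auto simp: E_def len)
      ultimately have "lookup b i \<le> d * (k * N)" by (rule order_trans[rotated])
      moreover have "lookup u i < N" using that(1) by (simp add: U_def exponent_box_def)
      ultimately show ?thesis unfolding b(2) K_def lookup_add by (simp add: algebra_simps)
    qed
    ultimately show "w \<in> T" by (simp add: T_def exponent_box_def)
  qed
  \<comment> \<open>The exponents \<open>n - card F\<close> from \<open>U\<close> and
    \<open>card F + 1\<close> from \<open>E\<close> add up to \<open>n + 1\<close>.\<close>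
  have "card (U \<times> E) = N ^ (n + 1)"
    using U E fF by (simp add: card_cartesian_product k_def flip: power_add power_Suc)
  moreover have "N ^ n * K ^ n < N ^ n * N" by (intro mult_strict_left_mono) (simp_all add: N_def)
  then have "(N * K) ^ n < N ^ (n + 1)" by (simp add: power_mult_distrib mult.commute)
  ultimately have "card T < card (U \<times> E)" using T by simp
  then obtain q where q: "\<exists>i\<in>U \<times> E. q i \<noteq> 0" "\<And>t. t \<in> T \<Longrightarrow> (\<Sum>i\<in>U \<times> E. q i * lookup (v i) t) = 0"
    using underdetermined_system[of T "U \<times> E" "\<lambda>i. lookup (v i)"] T U E by auto
  \<comment> \<open>Gathers the coefficients of the relation by power product, as polynomials in the
    variables outside \<open>F\<close>.\<close>
  define a where "a e = (\<Sum>u\<in>U. single u (q (u, e)))" for e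
  have la: "lookup (a e) u = (if u \<in> U then q (u, e) else 0)" for e u
    using U(1) by (simp add: a_def lookup_sum lookup_single when_def)
  define S where "S = {e \<in> E. a e \<noteq> 0}"
  have ka: "keys (a e) \<subseteq> U" for e by (auto simp: in_keys_iff la split: if_splits)
  have "(\<Sum>i\<in>U \<times> E. single 0 (q i) * v i) = 0"
  proof (rule poly_mapping_eqI)
    fix t
    have "lookup (single 0 c * p) t = c * lookup p t" for c and p :: "'k mpoly"
      unfolding mult_map_scale_conv_mult[symmetric] by (simp add: Poly_Mapping.map.rep_eq when_def)
    then have "lookup (\<Sum>i\<in>U \<times> E. single 0 (q i) * v i) t = (\<Sum>i\<in>U \<times> E. q i * lookup (v i) t)"
      by (simp add: lookup_sum)
    also have "\<dots> = 0"
    proof (cases "t \<in> T")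
      case False
      then have "lookup (v i) t = 0" if "i \<in> U \<times> E" for i
        using vT that unfolding not_in_keys_iff_lookup_eq_zero[symmetric] by (cases i) blast
      then show ?thesis by simp
    qed (rule q(2))
    finally show "lookup (\<Sum>i\<in>U \<times> E. single 0 (q i) * v i) t = lookup 0 t" by simp
  qed
  also have "(\<Sum>i\<in>U \<times> E. single 0 (q i) * v i) = (\<Sum>u\<in>U. \<Sum>e\<in>E. single u (q (u, e)) * list_monomial ys e)"
    unfolding sum.cartesian_product
    by (intro sum.cong) (auto simp: v_def mult_single mult.assoc[symmetric])
  also have "\<dots> = (\<Sum>e\<in>E. a e * list_monomial ys e)"
    by (subst sum.swap) (simp add: a_def sum_distrib_right)
  also have "\<dots> = (\<Sum>e\<in>S. a e * list_monomial ys e)"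
    using E by (intro sum.mono_neutral_right) (auto simp: S_def)
  finally have zero: "(\<Sum>e\<in>S. a e * list_monomial ys e) = 0" by simp
  have "(\<Sum>e\<in>S. a e * list_monomial ys e) \<notin> D 0"
  proof (rule list_monomial_combination_notin)
    show "finite S" using E by (simp add: S_def)
    obtain u e where ue: "u \<in> U" "e \<in> E" "q (u, e) \<noteq> 0" using q(1) by auto
    then have "lookup (a e) u \<noteq> 0" by (simp add: la)
    then have "a e \<noteq> 0" by auto
    then show "S \<noteq> {}" using ue by (auto simp: S_def)
  next
    fix e assume e: "e \<in> S"
    have "a e \<in> carrier (mpoly_ring n)"
      using ka[of e] by (force simp: carrier_mpoly_ring U_def exponent_box_def)
    moreover have "a e \<notin> var_ideal n F"
    proof
      assume *: "a e \<in> var_ideal n F"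
      have "keys (a e) \<noteq> {}" using e by (auto simp: S_def)
      then obtain u where u: "u \<in> keys (a e)" by blast
      then have "keys u \<inter> F \<noteq> {}" using * by (simp add: var_ideal_eq[OF F])
      moreover have "keys u \<inter> F = {}" using u ka[of e] by (auto simp: U_def exponent_box_def)
      ultimately show False by blast
    qed
    ultimately show "length e = length ys \<and> a e \<in> carrier (mpoly_ring n) - D (length ys)"
      using e by (simp add: S_def E_def len Dk)
  qed (use D Dstrict nth len in auto)
  then show False
    using zero ideal_mpolyD(2)[OF primeideal.axioms(1)[OF D[of 0]]] by simp
qed

lemma prime_height_var_ideal:
  assumes "F \<subseteq> {1..n}"
  shows "prime_height (mpoly_ring n) (var_ideal n F :: 'k::field mpoly set) = enat (card F)"
proof (rule antisym)
  show "prime_height (mpoly_ring n) (var_ideal n F :: 'k mpoly set) \<le> enat (card F)"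
    unfolding prime_height_def
  proof (rule Sup_least, clarify)
    fix m and C :: "nat \<Rightarrow> 'k mpoly set"
    assume "\<forall>i\<le>m. primeideal (C i) (mpoly_ring n)" "\<forall>i<m. C i \<subset> C (Suc i)" "C m = var_ideal n F"
    then show "enat m \<le> enat (card F)"
      using prime_chain_to_var_ideal_le[OF assms, of m C] by simp
  qed
qed (rule prime_height_var_ideal_ge[OF assms])

section \<open>Bases of matroids and paving matroids\<close>

locale finite_matroid =
  fixes E :: "'a set" and \<Delta> :: "'a set set" and c :: nat
  assumes matroid: "matroid E \<Delta>" and rank: "c = matroid_rank \<Delta>"
begin

lemma finite_ground: "finite E"
  and indep_subset_ground: "A \<in> \<Delta> \<Longrightarrow> A \<subseteq> E"
  and indep_empty: "{} \<in> \<Delta>"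
  and indep_subset: "A \<in> \<Delta> \<Longrightarrow> B \<subseteq> A \<Longrightarrow> B \<in> \<Delta>"
  and indep_augment: "A \<in> \<Delta> \<Longrightarrow> B \<in> \<Delta> \<Longrightarrow> card A < card B \<Longrightarrow> \<exists>x\<in>B - A. insert x A \<in> \<Delta>"
  using matroid unfolding matroid_def by blast+

lemma indep_finite: "A \<in> \<Delta> \<Longrightarrow> finite A"
  using indep_subset_ground finite_ground finite_subset by blast

lemma finite_indeps: "finite \<Delta>"
  by (rule finite_subset[of _ "Pow E"]) (use indep_subset_ground finite_ground in auto)

lemma card_indep_le: "A \<in> \<Delta> \<Longrightarrow> card A \<le> c"
  unfolding rank matroid_rank_def using finite_indeps by simp

lemma rank_attained: obtains A where "A \<in> \<Delta>" "card A = c"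
proof -
  have "c \<in> card ` \<Delta>"
    unfolding rank matroid_rank_def using finite_indeps indep_empty by (intro Max_in) auto
  then show ?thesis using that by auto
qed

lemma indep_extend:
  assumes "A \<in> \<Delta>"
  obtains F where "A \<subseteq> F" "F \<in> matroid_bases \<Delta>"
proof -
  obtain F where F: "F \<in> \<Delta>" "A \<subseteq> F" "\<forall>B\<in>\<Delta>. F \<subseteq> B \<longrightarrow> F = B"
    using finite_has_maximal2[OF finite_indeps assms] by metis
  then have "F \<in> matroid_bases \<Delta>" unfolding matroid_bases_def by fast
  then show ?thesis using F(2) that by blast
qed

lemma bases_indep: "F \<in> matroid_bases \<Delta> \<Longrightarrow> F \<in> \<Delta>"
  by (simp add: matroid_bases_def)

text \<open>A base smaller than the rank could be augmented from an independent set of maximal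
  size.\<close>

lemma card_bases: assumes F: "F \<in> matroid_bases \<Delta>" shows "card F = c"
proof (rule ccontr)
  assume "card F \<noteq> c"
  then have "card F < c" using card_indep_le[OF bases_indep[OF F]] by simp
  moreover obtain A where "A \<in> \<Delta>" "card A = c" by (rule rank_attained)
  ultimately obtain x where "x \<in> A - F" "insert x F \<in> \<Delta>"
    using indep_augment[OF bases_indep[OF F]] by blast
  then show False using F unfolding matroid_bases_def by blast
qed

lemma bases_nonempty: "matroid_bases \<Delta> \<noteq> {}"
  using indep_extend[OF indep_empty] by blast

lemma bases_antichain:
  "F \<in> matroid_bases \<Delta> \<Longrightarrow> G \<in> matroid_bases \<Delta> \<Longrightarrow> F \<subseteq> G \<Longrightarrow> F = G"
  unfolding matroid_bases_def by blast

lemma bases_subset_ground: "F \<in> matroid_bases \<Delta> \<Longrightarrow> F \<subseteq> E"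
  using bases_indep indep_subset_ground by blast

lemma rank_le_ground: "c \<le> card E"
  using rank_attained indep_subset_ground card_mono[OF finite_ground] by metis

lemma dependent_contains_circuit:
  assumes "A \<subseteq> E" "A \<notin> \<Delta>"
  obtains C where "C \<subseteq> A" "C \<in> matroid_circuits E \<Delta>"
proof -
  define \<D> where "\<D> = {B. B \<subseteq> A \<and> B \<notin> \<Delta>}"
  have "finite \<D>" "A \<in> \<D>"
    using assms finite_ground by (auto simp: \<D>_def intro: finite_subset[of _ "Pow E"])
  then obtain C where C: "C \<in> \<D>" "\<forall>B\<in>\<D>. B \<subseteq> C \<longrightarrow> C = B"
    using finite_has_minimal2[of \<D> A] by auto
  have CA: "C \<subseteq> A" "C \<notin> \<Delta>" using C(1) by (auto simp: \<D>_def)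
  have "D \<in> \<Delta>" if "D \<subset> C" for D
  proof (rule ccontr)
    assume "D \<notin> \<Delta>"
    then have "D \<in> \<D>" using that CA(1) by (auto simp: \<D>_def)
    then show False using C(2) that by auto
  qed
  then have "C \<in> matroid_circuits E \<Delta>"
    using CA assms(1) by (auto simp: matroid_circuits_def)
  then show ?thesis using CA(1) that by simp
qed

text \<open>Inclusion and exclusion for \<open>S \<union> F\<close> inside the ground set. This
  bound holds in any matroid and gives the half of \<open>paving_covers_iff\<close> that does not
  use paving.\<close>

lemma base_meets_cocard:
  assumes S: "S \<subseteq> E" and F: "F \<in> matroid_bases \<Delta>"
  shows "card S + c \<le> card E + card (S \<inter> F)"
proof -
  have fin: "finite S" "finite F" using S bases_subset_ground[OF F] finite_ground finite_subset by blast+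
  have "card (S \<union> F) \<le> card E"
    using S bases_subset_ground[OF F] finite_ground by (intro card_mono) auto
  then show ?thesis using card_Un_Int[OF fin] card_bases[OF F] by simp
qed

lemma card_Int_bases_compl:
  assumes F: "F \<in> matroid_bases \<Delta>"
  shows "card ((E - T) \<inter> F) + card (T \<inter> F) = c"
proof -
  have "card F = card ((E - T) \<inter> F \<union> T \<inter> F)"
    using bases_subset_ground[OF F] by (intro arg_cong[of _ _ card]) auto
  also have "\<dots> = card ((E - T) \<inter> F) + card (T \<inter> F)"
    using indep_finite[OF bases_indep[OF F]] by (intro card_Un_disjoint) auto
  finally show ?thesis using card_bases[OF F] by simp
qed

lemma paving_covers_iff:
  assumes pav: "paving E \<Delta>" and l: "2 \<le> l" "l \<le> c" and S: "S \<subseteq> E"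
  shows "(\<forall>F\<in>matroid_bases \<Delta>. l \<le> card (S \<inter> F)) \<longleftrightarrow> card E + l \<le> card S + c"
proof
  assume *: "\<forall>F\<in>matroid_bases \<Delta>. l \<le> card (S \<inter> F)"
  show "card E + l \<le> card S + c"
  proof (rule ccontr)
    assume "\<not> ?thesis"
    moreover have "card (E - S) = card E - card S"
      using S finite_ground by (intro card_Diff_subset) (auto intro: finite_subset)
    moreover have "card S \<le> card E" using S finite_ground by (intro card_mono)
    ultimately have "c - l + 1 \<le> card (E - S)" using l by simp
    \<comment> \<open>As \<open>l\<close> is at least 2, \<open>T\<close> has at most
      \<open>c - 1\<close> elements, too few to contain a circuit of a paving matroid; a base
      through \<open>T\<close> has only \<open>l - 1\<close> elements left for
      \<open>S\<close>.\<close>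
    then obtain T where T: "T \<subseteq> E - S" "card T = c - l + 1" by (meson obtain_subset_with_card_n)
    have "T \<in> \<Delta>"
    proof (rule ccontr)
      assume "T \<notin> \<Delta>"
      then obtain C where C: "C \<subseteq> T" "C \<in> matroid_circuits E \<Delta>"
        using dependent_contains_circuit T(1) by (metis Diff_subset subset_trans)
      have "card C \<le> card T" using C(1) T(1) finite_ground by (meson card_mono finite_Diff finite_subset)
      moreover have "c \<le> card C" using pav C(2) unfolding paving_def rank by blast
      ultimately show False using T(2) l by simp
    qed
    then obtain F where F: "T \<subseteq> F" "F \<in> matroid_bases \<Delta>" by (rule indep_extend)
    have "card T \<le> card ((E - S) \<inter> F)"
      using T F finite_ground by (intro card_mono) auto
    moreover have "(E - (E - S)) \<inter> F = S \<inter> F" using S by auto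
    ultimately have "card (S \<inter> F) < l"
      using card_Int_bases_compl[OF F(2), of "E - S"] T(2) l by simp
    then show False using * F(2) by force
  qed
next
  assume "card E + l \<le> card S + c"
  then show "\<forall>F\<in>matroid_bases \<Delta>. l \<le> card (S \<inter> F)" using base_meets_cocard[OF S] by force
qed

lemma small_double_cover_if_not_paving:
  assumes "\<not> paving E \<Delta>" "1 < c"
  obtains S where "S \<subseteq> E" "card S + c = card E + 1" "\<And>F. F \<in> matroid_bases \<Delta> \<Longrightarrow> 2 \<le> card (S \<inter> F)"
proof -
  obtain C where C: "C \<in> matroid_circuits E \<Delta>" "card C < c"
    using assms(1) matroid unfolding paving_def rank by auto
  have CE: "C \<subseteq> E" "C \<notin> \<Delta>" "\<And>D. D \<subset> C \<Longrightarrow> D \<in> \<Delta>"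
    using C(1) unfolding matroid_circuits_def by blast+
  have finC: "finite C" using CE(1) finite_ground finite_subset by blast
  have "C \<noteq> {}" using CE(2) indep_empty by auto
  then obtain x where x: "x \<in> C" by blast
  then have "C - {x} \<in> \<Delta>" by (intro CE(3)) auto
  then obtain F where F: "C - {x} \<subseteq> F" "F \<in> matroid_bases \<Delta>" by (rule indep_extend)
  \<comment> \<open>Otherwise the base would contain the whole circuit.\<close>
  have xF: "x \<notin> F" using F CE(2) indep_subset[OF bases_indep[OF F(2)], of C] by blast
  have finF: "finite F" by (rule indep_finite[OF bases_indep[OF F(2)]])
  have "card (C - {x}) \<le> c - 2" using x finC C(2) by simp
  moreover have "c - 2 \<le> card F" using card_bases[OF F(2)] by simp
  \<comment> \<open>Padding \<open>C - {x}\<close> inside the base \<open>F\<close> keeps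
    \<open>x\<close> out of \<open>I\<close>, so restoring \<open>x\<close> gives exactly
    \<open>c - 1\<close> elements and restores the circuit.\<close>
  ultimately obtain I where I: "C - {x} \<subseteq> I" "I \<subseteq> F" "card I = c - 2"
    using exists_subset_between[OF _ _ F(1) finF] by blast
  let ?T = "insert x I"
  have TE: "?T \<subseteq> E" using x CE(1) I(2) bases_subset_ground[OF F(2)] by blast
  have finT: "finite ?T" by (rule finite_subset[OF TE finite_ground])
  have cardT: "card ?T = c - 1"
    using I(2,3) xF finT assms(2) by (subst card_insert_disjoint) (simp, blast, simp)
  have "C \<subseteq> ?T" using I(1) by blast
  then have T: "?T \<notin> \<Delta>" using CE(2) indep_subset[of ?T C] by blast
  show ?thesis
  proof
    have "card (E - ?T) = card E - (c - 1)" using card_Diff_subset[OF finT TE] cardT by simp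
    moreover have "card ?T \<le> card E" using TE by (intro card_mono finite_ground)
    ultimately show "card (E - ?T) + c = card E + 1" using cardT assms(2) by simp
  next
    fix G assume G: "G \<in> matroid_bases \<Delta>"
    have "?T \<inter> G \<in> \<Delta>" by (rule indep_subset[OF bases_indep[OF G]]) blast
    then have "?T \<inter> G \<subset> ?T" using T by (metis inf.cobounded1 psubsetI)
    \<comment> \<open>A dependent set cannot lie in a base, so \<open>G\<close> contains at most
      \<open>c - 2\<close> elements of it and at least two outside.\<close>
    then have "card (?T \<inter> G) < c - 1" using psubset_card_mono[OF finT] cardT by metis
    then show "2 \<le> card ((E - ?T) \<inter> G)" using card_Int_bases_compl[OF G, of ?T] by simp
  qed blast
qed

end

section \<open>Degrees and initial degrees\<close>

lemma mpoly_monomial_nonzero: "mpoly_monomial m \<noteq> (0 :: 'k::field mpoly)"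
  by (metis keys_mpoly_monomial keys_zero insert_not_empty)

lemma card_keys_le_exponent_degree: "card (keys m) \<le> exponent_degree m"
  unfolding exponent_degree_def card_eq_sum by (intro sum_mono) (simp add: in_keys_iff Suc_le_eq)

lemma total_degree_ge:
  assumes "m \<in> keys p"
  shows "exponent_degree m \<le> total_degree p"
  unfolding total_degree_def using assms by (intro Max_ge) auto

lemma total_degree_sqfree_monomial:
  assumes "finite S"
  shows "total_degree (mpoly_monomial (sqfree_exponent_of S)) = card S"
  using assms by (simp add: total_degree_def exponent_degree_def lookup_sqfree_exponent_of)

lemma initial_degree_le: "p \<in> L \<Longrightarrow> p \<noteq> 0 \<Longrightarrow> initial_degree L \<le> total_degree p"
  unfolding initial_degree_def by (rule Least_le) blast

text \<open>By \<open>star_configuration_eq\<close> every monomial occurring has at least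
  \<open>n - h + 1\<close> variables, and a product of that many distinct variables attains the
  bound.\<close>

lemma initial_degree_star_configuration:
  assumes "1 \<le> h" "h \<le> n"
  shows "initial_degree (star_configuration n h :: 'k::field mpoly set) = n - h + 1"
  unfolding initial_degree_def
proof (rule Least_equality)
  have fin: "finite {1..n - h + 1}" by simp
  let ?p = "mpoly_monomial (sqfree_exponent_of {1..n - h + 1}) :: 'k mpoly"
  have "?p \<in> carrier (mpoly_ring n)" using assms by (intro mpoly_monomial_closed) auto
  then have "?p \<in> star_configuration n h" using assms fin by (simp add: star_configuration_eq)
  moreover have "?p \<noteq> 0" by (rule mpoly_monomial_nonzero)
  moreover have "total_degree ?p = n - h + 1" by (simp add: total_degree_sqfree_monomial)
  ultimately show "\<exists>f\<in>star_configuration n h. f \<noteq> (0 :: 'k mpoly) \<and> total_degree f = n - h + 1" by blast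
next
  fix d assume "\<exists>f\<in>star_configuration n h. f \<noteq> (0 :: 'k mpoly) \<and> total_degree f = d"
  then obtain f :: "'k mpoly" where f: "f \<in> star_configuration n h" "f \<noteq> 0" "total_degree f = d" by blast
  obtain m where m: "m \<in> keys f" using f(2) by (metis all_not_in_conv keys_eq_empty)
  then have "n < card (keys m) + h" using f(1) assms by (simp add: star_configuration_eq)
  then show "n - h + 1 \<le> d"
    using card_keys_le_exponent_degree[of m] total_degree_ge[OF m] f(3) assms(2) by linarith
qed

text \<open>The two cycles 1-2-3-5-1 and 1-2-4-5-1 connect all five statements.\<close>

lemma all_equivalent_five:
  assumes "P1 \<Longrightarrow> P2" "P2 \<Longrightarrow> P3" "P2 \<Longrightarrow> P4" "P3 \<Longrightarrow> P5" "P4 \<Longrightarrow> P5" "P5 \<Longrightarrow> P1"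
  shows "all_equivalent [P1, P2, P3, P4, P5]"
proof -
  have "P2 = P1" "P3 = P1" "P4 = P1" "P5 = P1" using assms by argo+
  then show ?thesis by (simp add: all_equivalent_def)
qed

theorem proposition7p3:
  fixes n c :: nat and \<Delta> :: "nat set set" and J :: "'k::field mpoly set"
  assumes "matroid {1..n} \<Delta>"
    and "J = cover_ideal n \<Delta>"
    and "c = matroid_rank \<Delta>"
    and "c > 1"
  shows "ideal_height (mpoly_ring n) J = enat c \<and>
    all_equivalent
      [paving {1..n} \<Delta>,
       \<forall>l\<in>{2..c}. SF n l J = star_configuration n (c - l + 1),
       \<forall>l\<in>{2..c}. initial_degree (SF n l J) = n - c + l,
       SF n 2 J = star_configuration n (c - 1),
       initial_degree (SF n 2 J) = n - c + 2]"
proof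
  interpret finite_matroid "{1..n}" \<Delta> c using assms by unfold_locales
  let ?B = "matroid_bases \<Delta>"
  have J: "J = (\<Inter>F\<in>?B. var_ideal n F)" unfolding assms(2) cover_ideal_def ..
  have finB: "finite ?B" by (rule finite_subset[OF _ finite_indeps]) (auto simp: matroid_bases_def)
  have cn: "c \<le> n" using rank_le_ground by simp
  show "ideal_height (mpoly_ring n) J = enat c"
    unfolding J
  proof (rule cring.ideal_height_Inter[OF cring_mpoly_ring])
    fix P assume "P \<in> var_ideal n ` ?B"
    then obtain F where F: "F \<in> ?B" "P = var_ideal n F" by blast
    then show "primeideal P (mpoly_ring n)" "prime_height (mpoly_ring n) P = enat c"
      using primeideal_var_ideal[OF bases_subset_ground[OF F(1)]]
        prime_height_var_ideal[OF bases_subset_ground[OF F(1)]] card_bases[OF F(1)] by simp_all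
  qed (use finB bases_nonempty in auto)
  have SF: "SF n l J = {p :: 'k mpoly. p \<in> carrier (mpoly_ring n) \<and>
      (\<forall>m\<in>keys p. \<forall>F\<in>?B. l \<le> card (keys m \<inter> F))}" for l
    unfolding J using finB bases_subset_ground bases_antichain bases_nonempty
    by (rule SF_Inter_var_ideals)
  have star: "\<forall>l\<in>{2..c}. SF n l J = star_configuration n (c - l + 1)" if pav: "paving {1..n} \<Delta>"
  proof
    fix l assume l: "l \<in> {2..c}"
    have "(\<forall>F\<in>?B. l \<le> card (keys m \<inter> F)) \<longleftrightarrow> n < card (keys m) + (c - l + 1)"
      if "keys m \<subseteq> {1..n}" for m :: "nat \<Rightarrow>\<^sub>0 nat"
      using paving_covers_iff[OF pav _ _ that, of l] l by auto
    moreover have "c - l + 1 \<le> n" using l cn unfolding atLeastAtMost_iff by linarith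
    ultimately show "SF n l J = star_configuration n (c - l + 1)"
      unfolding SF star_configuration_eq[OF \<open>c - l + 1 \<le> n\<close>] carrier_mpoly_ring by blast
  qed
  have deg: "initial_degree (SF n l J) = n - c + l"
    if "l \<in> {2..c}" "SF n l J = star_configuration n (c - l + 1)" for l
  proof -
    have "1 \<le> c - l + 1" "c - l + 1 \<le> n" "n - (c - l + 1) + 1 = n - c + l"
      using that(1) cn unfolding atLeastAtMost_iff by linarith+
    then show ?thesis
      unfolding that(2) using initial_degree_star_configuration[of "c - l + 1" n, where 'k = 'k] by metis
  qed
  have two: "2 \<in> {2..c}" "c - 2 + 1 = c - 1" using assms(4) by auto
  \<comment> \<open>Without paving, \<open>SF n 2 J\<close> contains a squarefree monomial of degree
    \<open>n - c + 1\<close>, one below the assumed initial degree.\<close>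
  have pav: "paving {1..n} \<Delta>" if *: "initial_degree (SF n 2 J) = n - c + 2"
  proof (rule ccontr)
    assume "\<not> paving {1..n} \<Delta>"
    then obtain S where S: "S \<subseteq> {1..n}" "card S + c = card {1..n} + 1"
        "\<And>F. F \<in> ?B \<Longrightarrow> 2 \<le> card (S \<inter> F)"
      using small_double_cover_if_not_paving assms(4) by blast
    have fin: "finite S" using S(1) finite_subset by blast
    let ?p = "mpoly_monomial (sqfree_exponent_of S) :: 'k mpoly"
    have "?p \<in> carrier (mpoly_ring n)" using S(1) fin by (intro mpoly_monomial_closed) simp
    then have "?p \<in> SF n 2 J" unfolding SF using S(3) fin by simp
    moreover have "?p \<noteq> 0" by (rule mpoly_monomial_nonzero)
    ultimately have "n - c + 2 \<le> card S"
      using initial_degree_le * total_degree_sqfree_monomial[OF fin] by metis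
    then show False using S(2) cn by simp
  qed
  show "all_equivalent
      [paving {1..n} \<Delta>,
       \<forall>l\<in>{2..c}. SF n l J = star_configuration n (c - l + 1),
       \<forall>l\<in>{2..c}. initial_degree (SF n l J) = n - c + l,
       SF n 2 J = star_configuration n (c - 1),
       initial_degree (SF n 2 J) = n - c + 2]"
  proof (rule all_equivalent_five)
    assume *: "\<forall>l\<in>{2..c}. SF n l J = star_configuration n (c - l + 1)"
    then show "\<forall>l\<in>{2..c}. initial_degree (SF n l J) = n - c + l" using deg by blast
    show "SF n 2 J = star_configuration n (c - 1)" using bspec[OF * two(1)] unfolding two(2) .
  next
    assume "\<forall>l\<in>{2..c}. initial_degree (SF n l J) = n - c + l"
    then show "initial_degree (SF n 2 J) = n - c + 2" using two(1) by blast
  next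
    assume "SF n 2 J = star_configuration n (c - 1)"
    then show "initial_degree (SF n 2 J) = n - c + 2" using deg[OF two(1)] unfolding two(2) by blast
  qed (fact star pav)+
qed

end
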